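(* Let $M$ be a conservative superalgebra over a field $\mathbb{F}$ on an underlying superspace $V$, with Jacobi subspace $J$, and let $*$ be an associated multiplication. Let $W=V/J$ if $M$ has a left quasiunity $e$ (and then put $\epsilon = e \bmod J\in W$), and let $W=V/J\oplus\mathbb{F}\epsilon$ with $\epsilon$ an even basis element if $M$ has no left quasiunity. Then the adjoint mapping $$\operatorname{ad}: M\to(\mathcal{U}(W),\bigtriangleup_{-\epsilon})$$ is a homomorphism of superalgebras whose kernel is the maximal Jacobi ideal of $M$. In particular, if $V$ is finite-dimensional and $J$ is of codimension $n+m$ (that is, $\dim (V/J)_{\bar 0}=n$ and $\dim (V/J)_{\bar 1}=m$), then there is a homomorphism $\operatorname{ad}: M\to\mathcal{U}(k,m)$ with kernel the maximal Jacobi ideal, where $k=n$ if $M$ has a left quasiunity and $k=n+1$ otherwise.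
   Context: All spaces are over a field $\mathbb{F}$; a superspace is a $\mathbb{Z}_2$-graded space $V=V_{\bar0}\oplus V_{\bar1}$, and $|x|$ denotes the parity of a homogeneous $x$. Formulas with signs are stated for homogeneous elements and extended by linearity; subspaces and ideals are assumed homogeneous (graded). Superalgebras are not assumed associative, commutative or unital. A superalgebra on $V$ is an even bilinear map $M(x,y)=xy$ on $V$ ($V_{\bar i}V_{\bar j}\subseteq V_{\overline{i+j}}$). $L_a(x)=ax$. For a linear operator $A$ and a bilinear operation $B$ on $V$ put $$[A,B](x,y)=A(B(x,y))-(-1)^{|A||B|}B(A(x),y)-(-1)^{|A|(|B|+|x|)}B(x,A(y)).$$ $M$ is conservative if there is an even bilinear operation $a*b$ on $V$ (an associated multiplication) with $[L_b,[L_a,M]]=-(-1)^{|a||b|}[L_{a*b},M]$ for all homogeneous $a,b\in V$. A Jacobi element is an element $a$ such that $L_a$ is a superderivation of $M$, i.e. $a(xy)=(ax)y+(-1)^{|a||x|}x(ay)$ for all $x,y$; equivalently $[L_a,M]=0$. $J$ is the (graded) space of all Jacobi elements. A Jacobi ideal is a two-sided ideal of $M$ contained in $J$; the maximal Jacobi ideal is the largest one (the sum of all Jacobi ideals). A left quasiunity is an even element $e$ with $e(xy)=(ex)y+x(ey)-xy$ for all $x,y$. For a superspace $W$, $\mathcal{U}(W)$ is the superspace of all bilinear operations $W\times W\to W$ (an operation $B$ has parity $|B|$ if $B(W_{\bar i},W_{\bar j})\subseteq W_{\overline{i+j+|B|}}$). For an even $u\in W$ the product $\bigtriangleup_u$ on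 $\mathcal{U}(W)$ is $$(A\bigtriangleup_u B)(x,y)=A(u,B(x,y))-(-1)^{|A||B|}B(A(u,x),y)-(-1)^{|A|(|B|+|x|)}B(x,A(u,y)).$$ Different nonzero even vectors $u$ give isomorphic superalgebras; for $W$ with $\dim W_{\bar0}=k$, $\dim W_{\bar1}=m$, $\mathcal{U}(k,m)$ denotes $(\mathcal{U}(W),\bigtriangleup_u)$ for any nonzero even $u$ (and $\mathcal{U}(0,0)=0$). The adjoint mapping $\operatorname{ad}:M\to\mathcal{U}(W)$ is the linear map defined, for homogeneous $a\in V$ and $\alpha,\beta\in V$ (whose classes in $V/J$ are denoted by the same letters, all values being taken modulo $J$), by $$\operatorname{ad}(a)(\alpha,\beta)=(-1)^{|\beta|(|a|+|\alpha|)}\big((\beta*a)*\alpha+(-1)^{|\alpha||a|}\beta*(\alpha a)-(-1)^{|\alpha||a|}(\beta*\alpha)*a\big),$$ and, if $M$ has no left quasiunity, additionally by $$\operatorname{ad}(a)(\alpha,\epsilon)=a*\alpha+(-1)^{|\alpha||a|}\alpha a-(-1)^{|\alpha||a|}\alpha*a,$$ $$\operatorname{ad}(a)(\epsilon,\beta)=(-1)^{|a||\beta|}\beta*a,\qquad \operatorname{ad}(a)(\epsilon,\epsilon)=a.$$ These formulas are well defined modulo $J$ and do not depend on the choice of the associated multiplication $*$. *)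

theory Defs
  imports "HOL-Library.Z2" "HOL-Library.FuncSet" "HOL.Vector_Spaces"
begin

text \<open>
  Parities are elements of the two-element field, so \<^term>\<open>psign (p * q)\<close> is
  the sign \<open>(-1)^(p q)\<close>.
\<close>

definition psign :: "bit \<Rightarrow> 'f::field" where
  "psign p = (if p = 0 then 1 else - 1)"


subsection \<open>Superspaces with an explicit carrier\<close>

text \<open>
  Quotients \<open>V/J\<close> and spaces of bilinear operations are not types, so superspaces are
  represented by records; \<open>part S p\<close> is the homogeneous component of parity \<open>p\<close>.
\<close>

record ('f, 'w) sspace =
  carr :: "'w set"
  add :: "'w \<Rightarrow> 'w \<Rightarrow> 'w"
  zer :: "'w"
  scl :: "'f \<Rightarrow> 'w \<Rightarrow> 'w"
  part :: "bit \<Rightarrow> 'w set"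

definition neg :: "('f::field, 'w) sspace \<Rightarrow> 'w \<Rightarrow> 'w" where
  "neg S x = scl S (- 1) x"

definition sub :: "('f::field, 'w) sspace \<Rightarrow> 'w \<Rightarrow> 'w \<Rightarrow> 'w" where
  "sub S x y = add S x (neg S y)"

definition subspace_of :: "('f::field, 'w) sspace \<Rightarrow> 'w set \<Rightarrow> bool" where
  "subspace_of S U \<longleftrightarrow> U \<subseteq> carr S \<and> zer S \<in> U \<and>
     (\<forall>x\<in>U. \<forall>y\<in>U. add S x y \<in> U) \<and> (\<forall>c. \<forall>x\<in>U. scl S c x \<in> U)"

definition is_superspace :: "('f::field, 'w) sspace \<Rightarrow> bool" where
  "is_superspace S \<longleftrightarrow>
     subspace_of S (carr S) \<and>
     (\<forall>x\<in>carr S. \<forall>y\<in>carr S. \<forall>z\<in>carr S. add S (add S x y) z = add S x (add S y z)) \<and>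
     (\<forall>x\<in>carr S. \<forall>y\<in>carr S. add S x y = add S y x) \<and>
     (\<forall>x\<in>carr S. add S x (zer S) = x \<and> add S x (neg S x) = zer S) \<and>
     (\<forall>c. \<forall>x\<in>carr S. \<forall>y\<in>carr S. scl S c (add S x y) = add S (scl S c x) (scl S c y)) \<and>
     (\<forall>c d. \<forall>x\<in>carr S. scl S (c + d) x = add S (scl S c x) (scl S d x)) \<and>
     (\<forall>c d. \<forall>x\<in>carr S. scl S (c * d) x = scl S c (scl S d x)) \<and>
     (\<forall>x\<in>carr S. scl S 1 x = x) \<and>
     (\<forall>p. subspace_of S (part S p)) \<and>
     (\<forall>x\<in>carr S. \<exists>!y. y \<in> part S 0 \<and> (\<exists>z\<in>part S 1. x = add S y z))"

text \<open>Sum over both parities, used to extend formulas from homogeneous elements by linearity.\<close>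

definition parity_sum :: "('f::field, 'w) sspace \<Rightarrow> (bit \<Rightarrow> 'w) \<Rightarrow> 'w" where
  "parity_sum S f = add S (f 0) (f 1)"

definition component :: "('f::field, 'w) sspace \<Rightarrow> bit \<Rightarrow> 'w \<Rightarrow> 'w" where
  "component S p x = (THE y. y \<in> part S p \<and> (\<exists>z\<in>part S (p + 1). x = add S y z))"

text \<open>A subspace \<open>U\<close> has dimension \<open>n\<close> if it has a basis with \<open>n\<close> elements.\<close>

definition lincomb :: "('f::field, 'w) sspace \<Rightarrow> 'f list \<Rightarrow> 'w list \<Rightarrow> 'w" where
  "lincomb S cs bs = foldr (\<lambda>(c, b) acc. add S (scl S c b) acc) (zip cs bs) (zer S)"

definition has_dim :: "('f::field, 'w) sspace \<Rightarrow> 'w set \<Rightarrow> nat \<Rightarrow> bool" where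
  "has_dim S U n \<longleftrightarrow> (\<exists>bs. length bs = n \<and> set bs \<subseteq> U \<and>
     (\<forall>x\<in>U. \<exists>!cs. length cs = n \<and> lincomb S cs bs = x))"

definition has_sdim :: "('f::field, 'w) sspace \<Rightarrow> nat \<Rightarrow> nat \<Rightarrow> bool" where
  "has_sdim S n m \<longleftrightarrow> has_dim S (part S 0) n \<and> has_dim S (part S 1) m"

definition linear_on :: "('f::field, 'w) sspace \<Rightarrow> ('f, 'u) sspace \<Rightarrow> ('w \<Rightarrow> 'u) \<Rightarrow> bool" where
  "linear_on S T f \<longleftrightarrow>
     f \<in> carr S \<rightarrow> carr T \<and>
     (\<forall>x\<in>carr S. \<forall>y\<in>carr S. f (add S x y) = add T (f x) (f y)) \<and>
     (\<forall>c. \<forall>x\<in>carr S. f (scl S c x) = scl T c (f x))"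

text \<open>
  The superspace of all bilinear operations. Operations are extensional (undefined outside
  the carrier), so that equality of operations is equality on the carrier.
\<close>

definition bilinear_ops :: "('f::field, 'w) sspace \<Rightarrow> ('w \<Rightarrow> 'w \<Rightarrow> 'w) set" where
  "bilinear_ops S = {B \<in> carr S \<rightarrow>\<^sub>E (carr S \<rightarrow>\<^sub>E carr S).
     (\<forall>x\<in>carr S. linear_on S S (B x)) \<and> (\<forall>y\<in>carr S. linear_on S S (\<lambda>x. B x y))}"

definition bilinear_space :: "('f::field, 'w) sspace \<Rightarrow> ('f, 'w \<Rightarrow> 'w \<Rightarrow> 'w) sspace" where
  "bilinear_space S =
     \<lparr> carr = bilinear_ops S,
       add = (\<lambda>A B. \<lambda>x\<in>carr S. \<lambda>y\<in>carr S. add S (A x y) (B x y)),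
       zer = (\<lambda>x\<in>carr S. \<lambda>y\<in>carr S. zer S),
       scl = (\<lambda>c A. \<lambda>x\<in>carr S. \<lambda>y\<in>carr S. scl S c (A x y)),
       part = (\<lambda>p. {B \<in> bilinear_ops S.
         \<forall>i j. \<forall>x\<in>part S i. \<forall>y\<in>part S j. B x y \<in> part S (i + j + p)}) \<rparr>"

text \<open>
  \<open>[A, B](x, y)\<close> for \<open>A\<close>, \<open>B\<close>, \<open>x\<close> homogeneous of parities \<open>p\<close>, \<open>q\<close>, \<open>r\<close>,
  and its linear extension to arbitrary \<open>x\<close>.
\<close>

definition hbracket ::
  "('f::field, 'w) sspace \<Rightarrow> bit \<Rightarrow> bit \<Rightarrow> bit \<Rightarrow> ('w \<Rightarrow> 'w) \<Rightarrow> ('w \<Rightarrow> 'w \<Rightarrow> 'w) \<Rightarrow> 'w \<Rightarrow> 'w \<Rightarrow> 'w" where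
  "hbracket S p q r A B x y =
     sub S (sub S (A (B x y)) (scl S (psign (p * q)) (B (A x) y)))
           (scl S (psign (p * (q + r))) (B x (A y)))"

definition bracket ::
  "('f::field, 'w) sspace \<Rightarrow> bit \<Rightarrow> bit \<Rightarrow> ('w \<Rightarrow> 'w) \<Rightarrow> ('w \<Rightarrow> 'w \<Rightarrow> 'w) \<Rightarrow> 'w \<Rightarrow> 'w \<Rightarrow> 'w" where
  "bracket S p q A B x y = parity_sum S (\<lambda>r. hbracket S p q r A B (component S r x) y)"

text \<open>
  The product \<open>A \<triangle>\<^sub>u B = [A(u, -), B]\<close> for even \<open>u\<close>; \<open>A(u, -)\<close> has the parity of \<open>A\<close>.
\<close>

definition triangle ::
  "('f::field, 'w) sspace \<Rightarrow> 'w \<Rightarrow> ('w \<Rightarrow> 'w \<Rightarrow> 'w) \<Rightarrow> ('w \<Rightarrow> 'w \<Rightarrow> 'w) \<Rightarrow> 'w \<Rightarrow> 'w \<Rightarrow> 'w" where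
  "triangle S u A B = (\<lambda>x\<in>carr S. \<lambda>y\<in>carr S.
     parity_sum S (\<lambda>p. parity_sum S (\<lambda>q.
       bracket S p q (component (bilinear_space S) p A u) (component (bilinear_space S) q B) x y)))"

text \<open>
  \<open>(\<U>(W), \<triangle>\<^sub>u)\<close> is a copy of \<open>\<U>(k, m)\<close>. For \<open>k = 0\<close> the only choice is
  \<open>u = 0\<close>, with zero product; this includes \<open>\<U>(0, 0) = 0\<close>.
\<close>

definition represents_U :: "('f::field, 'w) sspace \<Rightarrow> 'w \<Rightarrow> nat \<Rightarrow> nat \<Rightarrow> bool" where
  "represents_U W u k m \<longleftrightarrow>
     is_superspace W \<and> has_sdim W k m \<and> u \<in> part W 0 \<and> (u \<noteq> zer W \<or> k = 0)"

text \<open>Superalgebras are pairs of a superspace and a product. Homomorphisms are even linear maps.\<close>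

definition superalgebra_hom ::
  "('f::field, 'w) sspace \<Rightarrow> ('w \<Rightarrow> 'w \<Rightarrow> 'w) \<Rightarrow> ('f, 'u) sspace \<Rightarrow> ('u \<Rightarrow> 'u \<Rightarrow> 'u) \<Rightarrow> ('w \<Rightarrow> 'u) \<Rightarrow> bool"
where
  "superalgebra_hom S M T N f \<longleftrightarrow>
     linear_on S T f \<and> (\<forall>p. f ` part S p \<subseteq> part T p) \<and>
     (\<forall>x\<in>carr S. \<forall>y\<in>carr S. f (M x y) = N (f x) (f y))"

definition hom_kernel :: "('f::field, 'w) sspace \<Rightarrow> ('f, 'u) sspace \<Rightarrow> ('w \<Rightarrow> 'u) \<Rightarrow> 'w set" where
  "hom_kernel S T f = {x \<in> carr S. f x = zer T}"

text \<open>\<open>adjoin_even S\<close> is \<open>S \<oplus> F \<epsilon>\<close> with \<open>\<epsilon>\<close> even, and \<open>(x, t)\<close> stands for \<open>x + t \<epsilon>\<close>.\<close>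

definition adjoin_even :: "('f::field, 'w) sspace \<Rightarrow> ('f, 'w \<times> 'f) sspace" where
  "adjoin_even S =
     \<lparr> carr = carr S \<times> UNIV,
       add = (\<lambda>(x, s) (y, t). (add S x y, s + t)),
       zer = (zer S, 0),
       scl = (\<lambda>c (x, s). (scl S c x, c * s)),
       part = (\<lambda>p. part S p \<times> (if p = 0 then UNIV else {0})) \<rparr>"

definition adjoined_unit :: "('f::field, 'w) sspace \<Rightarrow> 'w \<times> 'f" where
  "adjoined_unit S = (zer S, 1)"


subsection \<open>Superspaces as types, and superalgebras on them\<close>

locale superspace = vector_space scale
  for scale :: "'f::field \<Rightarrow> 'v::ab_group_add \<Rightarrow> 'v" (infixr "*s" 75) +
  fixes G :: "bit \<Rightarrow> 'v set"
  assumes subspace_part: "subspace (G p)"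
    and parity_decomposition: "\<exists>!y. y \<in> G 0 \<and> x - y \<in> G 1"
begin

definition space :: "('f, 'v) sspace" where
  "space = \<lparr> carr = UNIV, add = (+), zer = 0, scl = scale, part = G \<rparr>"

text \<open>The bilinear operation \<open>M\<close> is a superalgebra structure iff it is even.\<close>

definition superalgebra :: "('v \<Rightarrow> 'v \<Rightarrow> 'v) \<Rightarrow> bool" where
  "superalgebra M \<longleftrightarrow> M \<in> part (bilinear_space space) 0"

text \<open>Here \<open>M a\<close> is the left multiplication \<open>L\<^sub>a\<close>.\<close>

definition associated_mult :: "('v \<Rightarrow> 'v \<Rightarrow> 'v) \<Rightarrow> ('v \<Rightarrow> 'v \<Rightarrow> 'v) \<Rightarrow> bool" where
  "associated_mult M star \<longleftrightarrow>
     star \<in> part (bilinear_space space) 0 \<and>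
     (\<forall>i j. \<forall>a\<in>G i. \<forall>b\<in>G j. \<forall>x y.
        bracket space j i (M b) (bracket space i 0 (M a) M) x y =
        - (psign (i * j) *s bracket space (i + j) 0 (M (star a b)) M x y))"

definition conservative :: "('v \<Rightarrow> 'v \<Rightarrow> 'v) \<Rightarrow> bool" where
  "conservative M \<longleftrightarrow> (\<exists>star. associated_mult M star)"

definition superderivation :: "('v \<Rightarrow> 'v \<Rightarrow> 'v) \<Rightarrow> bit \<Rightarrow> ('v \<Rightarrow> 'v) \<Rightarrow> bool" where
  "superderivation M p D \<longleftrightarrow>
     (\<forall>r. \<forall>x\<in>G r. \<forall>y. D (M x y) = M (D x) y + psign (p * r) *s M x (D y))"

definition jacobi_space :: "('v \<Rightarrow> 'v \<Rightarrow> 'v) \<Rightarrow> 'v set" where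
  "jacobi_space M = {a. \<forall>p. superderivation M p (M (component space p a))}"

definition graded_subspace :: "'v set \<Rightarrow> bool" where
  "graded_subspace U \<longleftrightarrow> subspace U \<and> (\<forall>x\<in>U. \<forall>p. component space p x \<in> U)"

definition two_sided_ideal :: "('v \<Rightarrow> 'v \<Rightarrow> 'v) \<Rightarrow> 'v set \<Rightarrow> bool" where
  "two_sided_ideal M I \<longleftrightarrow> graded_subspace I \<and> (\<forall>x. \<forall>a\<in>I. M x a \<in> I \<and> M a x \<in> I)"

definition jacobi_ideal :: "('v \<Rightarrow> 'v \<Rightarrow> 'v) \<Rightarrow> 'v set \<Rightarrow> bool" where
  "jacobi_ideal M I \<longleftrightarrow> two_sided_ideal M I \<and> I \<subseteq> jacobi_space M"

definition maximal_jacobi_ideal :: "('v \<Rightarrow> 'v \<Rightarrow> 'v) \<Rightarrow> 'v set \<Rightarrow> bool" where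
  "maximal_jacobi_ideal M I \<longleftrightarrow> jacobi_ideal M I \<and> (\<forall>I'. jacobi_ideal M I' \<longrightarrow> I' \<subseteq> I)"

definition left_quasiunity :: "('v \<Rightarrow> 'v \<Rightarrow> 'v) \<Rightarrow> 'v \<Rightarrow> bool" where
  "left_quasiunity M e \<longleftrightarrow> e \<in> G 0 \<and>
     (\<forall>x y. M e (M x y) = M (M e x) y + M x (M e y) - M x y)"


subsection \<open>The quotient by a graded subspace\<close>

definition coset :: "'v set \<Rightarrow> 'v \<Rightarrow> 'v set" where
  "coset J x = {x + j | j. j \<in> J}"

text \<open>
  Operations on cosets are defined as unions over all representatives. If the operation on
  representatives respects \<open>J\<close>, then all members of the union are the same coset.
\<close>

definition quotient :: "'v set \<Rightarrow> ('f, 'v set) sspace" where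
  "quotient J =
     \<lparr> carr = range (coset J),
       add = (\<lambda>X Y. \<Union>x\<in>X. \<Union>y\<in>Y. coset J (x + y)),
       zer = coset J 0,
       scl = (\<lambda>c X. \<Union>x\<in>X. coset J (c *s x)),
       part = (\<lambda>p. coset J ` G p) \<rparr>"


subsection \<open>The adjoint mapping\<close>

text \<open>
  Linear extensions to arbitrary arguments of the formulas for \<open>ad(a)(\<alpha>, \<beta>)\<close>,
  \<open>ad(a)(\<alpha>, \<epsilon>)\<close> and \<open>ad(a)(\<epsilon>, \<beta>)\<close>, with \<open>x\<close>, \<open>y\<close> representing \<open>\<alpha>\<close>, \<open>\<beta>\<close>
  and \<open>i\<close>, \<open>j\<close>, \<open>k\<close> the parities of \<open>a\<close>, \<open>x\<close>, \<open>y\<close>.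
\<close>

definition ad_main :: "('v \<Rightarrow> 'v \<Rightarrow> 'v) \<Rightarrow> ('v \<Rightarrow> 'v \<Rightarrow> 'v) \<Rightarrow> 'v \<Rightarrow> 'v \<Rightarrow> 'v \<Rightarrow> 'v" where
  "ad_main M star a x y =
     (\<Sum>i\<in>{0, 1}. \<Sum>j\<in>{0, 1}. \<Sum>k\<in>{0, 1}.
        let a' = component space i a; x' = component space j x; y' = component space k y in
        psign (k * (i + j)) *s
          (star (star y' a') x' + psign (j * i) *s star y' (M x' a')
            - psign (j * i) *s star (star y' x') a'))"

definition ad_right :: "('v \<Rightarrow> 'v \<Rightarrow> 'v) \<Rightarrow> ('v \<Rightarrow> 'v \<Rightarrow> 'v) \<Rightarrow> 'v \<Rightarrow> 'v \<Rightarrow> 'v" where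
  "ad_right M star a x =
     (\<Sum>i\<in>{0, 1}. \<Sum>j\<in>{0, 1}.
        let a' = component space i a; x' = component space j x in
        star a' x' + psign (j * i) *s M x' a' - psign (j * i) *s star x' a')"

definition ad_left :: "('v \<Rightarrow> 'v \<Rightarrow> 'v) \<Rightarrow> 'v \<Rightarrow> 'v \<Rightarrow> 'v" where
  "ad_left star a y =
     (\<Sum>i\<in>{0, 1}. \<Sum>k\<in>{0, 1}.
        let a' = component space i a; y' = component space k y in
        psign (i * k) *s star y' a')"

text \<open>The adjoint mapping in the presence of a left quasiunity, where \<open>W = V/J\<close>.\<close>

definition ad_quasiunital ::
  "('v \<Rightarrow> 'v \<Rightarrow> 'v) \<Rightarrow> ('v \<Rightarrow> 'v \<Rightarrow> 'v) \<Rightarrow> 'v \<Rightarrow> 'v set \<Rightarrow> 'v set \<Rightarrow> 'v set" where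
  "ad_quasiunital M star a =
     (let J = jacobi_space M; W = quotient J in
      (\<lambda>X\<in>carr W. \<lambda>Y\<in>carr W. \<Union>x\<in>X. \<Union>y\<in>Y. coset J (ad_main M star a x y)))"

text \<open>The adjoint mapping in the absence of left quasiunities, where \<open>W = V/J \<oplus> F \<epsilon>\<close>.\<close>

definition ad_extended ::
  "('v \<Rightarrow> 'v \<Rightarrow> 'v) \<Rightarrow> ('v \<Rightarrow> 'v \<Rightarrow> 'v) \<Rightarrow> 'v \<Rightarrow> 'v set \<times> 'f \<Rightarrow> 'v set \<times> 'f \<Rightarrow> 'v set \<times> 'f" where
  "ad_extended M star a =
     (let J = jacobi_space M; W = adjoin_even (quotient J) in
      (\<lambda>(X, s)\<in>carr W. \<lambda>(Y, t)\<in>carr W.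
        (\<Union>x\<in>X. \<Union>y\<in>Y. coset J (ad_main M star a x y + t *s ad_right M star a x
            + s *s ad_left star a y + (s * t) *s a), 0)))"

end

end

theory Submission
  imports Defs
begin

text \<open>
  The map \<open>\<Phi>\<close> sending \<open>\<alpha>\<close> to \<open>[L\<^sub>\<alpha>, M]\<close> and \<open>\<epsilon>\<close> to \<open>- M\<close> identifies \<open>W\<close> with a space of bilinear
  operations on \<open>V\<close>: its kernel on \<open>V\<close> is \<open>J\<close>, and \<open>M\<close> is of the form \<open>[L\<^sub>a, M]\<close> exactly if there
  is a left quasiunity. Conservativity makes this space stable under all \<open>[L\<^sub>a, -]\<close>, and the formulas
  defining \<open>ad\<close> say that \<open>\<Phi>(ad(a)(\<alpha>, \<beta>)) = (-1)^(|a||\<alpha>|) [\<Phi>(\<alpha>)(a, -), \<Phi>(\<beta>)]\<close>. In particular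
  \<open>ad(a)(-\<epsilon>, -)\<close> is the action of \<open>L\<^sub>a\<close>, so the homomorphism property follows from the Jacobi identity.
  Evaluation at \<open>(\<epsilon>, \<epsilon>)\<close> shows that the kernel lies in \<open>J\<close>, whereas for \<open>c\<close> in a Jacobi ideal
  \<open>L\<^sub>c\<close> kills every \<open>[L\<^sub>\<beta>, M]\<close>, since \<open>c \<beta>\<close> is again a Jacobi element.
\<close>

text \<open>The base point - \<epsilon> comes from the left quasiunity: its defining identity reads
  [L_e, M] = - M. So \<Phi> has to send \<epsilon> to - M, and it is - \<epsilon> whose image is M,
  which makes \<Phi>(- \<epsilon>)(a, -) exactly L_a. The obstacle is that W has three shapes: V/J,
  V/J with \<epsilon> adjoined, and an arbitrary model of U(k, m). The locale
  \<open>adjoint_rep\<close> keeps only what the argument uses: \<Phi> is linear, injective,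
  compatible with parity, and turns \<open>ad\<close> into brackets. The multiplication
  \<open>star\<close> no longer occurs there, so homomorphism and kernel are settled once and each
  shape only needs an instance. Since the kernel of \<Phi> is known, parities of values,
  well-definedness modulo J and identities in W are all read off from operations on the type
  \<open>'v\<close>. For a Jacobi ideal I and c in I it is not enough that L_c kills every
  \<Phi>(\<beta>). The operator to be applied is \<Phi>(\<alpha>)(c, -), which for \<alpha> in V is
  the supercommutator of L_\<alpha> and L_c minus left multiplication by \<alpha> c; here \<alpha> c
  in I is used as well.\<close>

subsection \<open>Bilinear operations on a superspace\<close>

text \<open>These rules rewrite arithmetic on parities to \<open>XOR\<close> and \<open>AND\<close>, on which \<open>ac_simps\<close> is useless.\<close>

declare add_bit_eq_xor [simp del] mult_bit_eq_and [simp del]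

lemma bit_add_self [simp]: "p + p = (0::bit)"
  by (cases p) auto

lemma psign_simps [simp]: "psign 0 = 1" "psign 1 = - 1"
  by (simp_all add: psign_def)

context superspace
begin

abbreviation comp :: "bit \<Rightarrow> 'v \<Rightarrow> 'v" where "comp \<equiv> component space"

lemma space_simps [simp]:
  "carr space = UNIV" "add space = (+)" "zer space = 0" "scl space = scale" "part space = G"
  by (simp_all add: space_def)

lemma neg_space [simp]: "neg space x = - x"
  by (simp add: neg_def)

lemma sub_space [simp]: "sub space x y = x - y"
  by (simp add: sub_def)

lemmas G_add = subspace_add[OF subspace_part]
  and G_diff = subspace_diff[OF subspace_part]
  and G_neg = subspace_neg[OF subspace_part]
  and G_scale = subspace_scale[OF subspace_part]
  and G_0 = subspace_0[OF subspace_part]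

lemmas G_intros = G_add G_diff G_neg G_scale G_0

lemma G_Int: "x \<in> G 0 \<Longrightarrow> x \<in> G 1 \<Longrightarrow> x = 0"
  using parity_decomposition[of x] G_0[of 0] G_0[of 1] by (metis diff_self diff_zero)

lemma G_Int': "x \<in> G p \<Longrightarrow> x \<in> G q \<Longrightarrow> p \<noteq> q \<Longrightarrow> x = 0"
  using G_Int by (cases p; cases q) auto

lemma comp_unique:
  assumes "y \<in> G p" "z \<in> G (p + 1)"
  shows "comp p (y + z) = y"
  unfolding component_def space_simps
proof (rule the_equality)
  show "y \<in> G p \<and> (\<exists>w\<in>G (p + 1). y + z = y + w)"
    using assms by blast
  fix y' assume "y' \<in> G p \<and> (\<exists>w\<in>G (p + 1). y + z = y' + w)"
  then obtain w where w: "y' \<in> G p" "w \<in> G (p + 1)" "y + z = y' + w" by blast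
  then have "y - y' = w - z" by (simp add: algebra_simps)
  moreover have "y - y' \<in> G p" "w - z \<in> G (p + 1)"
    using assms w by (auto intro: G_intros)
  ultimately have "y - y' = 0"
    using G_Int'[of "y - y'" p "p + 1"] by (cases p) auto
  then show "y' = y" by simp
qed

lemma ex_decomposition: "\<exists>y\<in>G 0. \<exists>z\<in>G 1. x = y + z"
  using parity_decomposition[of x] by (metis add.commute diff_add_cancel)

lemma comp_in [simp]: "comp p x \<in> G p"
  and comp_sum: "comp 0 x + comp 1 x = x"
proof -
  obtain y z where yz: "y \<in> G 0" "z \<in> G 1" "x = y + z" using ex_decomposition by blast
  have "comp 0 x = y" using comp_unique[of y 0 z] yz by simp
  moreover have "comp 1 x = z" using comp_unique[of z 1 y] yz by (simp add: add.commute)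
  ultimately show "comp p x \<in> G p" "comp 0 x + comp 1 x = x"
    using yz by (cases p; simp)+
qed

lemma comp_homogeneous: "x \<in> G p \<Longrightarrow> comp q x = (if q = p then x else 0)"
  using comp_unique[of x q 0] comp_unique[of 0 q x] G_0
  by (cases p; cases q) auto

lemma comp_sum': "comp p x + comp (p + 1) x = x"
  using comp_sum[of x] by (cases p) (auto simp: add.commute)

lemma comp_add: "comp p (x + y) = comp p x + comp p y"
proof -
  have "x + y = (comp p x + comp (p + 1) x) + (comp p y + comp (p + 1) y)"
    by (simp add: comp_sum')
  then have "x + y = (comp p x + comp p y) + (comp (p + 1) x + comp (p + 1) y)"
    by (simp add: ac_simps)
  then show ?thesis
    using comp_unique[of "comp p x + comp p y" p] by (metis G_add comp_in)
qed

lemma comp_scale: "comp p (c *s x) = c *s comp p x"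
proof -
  have "c *s x = c *s comp p x + c *s comp (p + 1) x"
    by (simp add: comp_sum' scale_right_distrib[symmetric])
  then show ?thesis
    using comp_unique[of "c *s comp p x" p] by (metis G_scale comp_in)
qed

lemma comp_neg: "comp p (- x) = - comp p x"
  using comp_scale[of p "- 1" x] by simp

lemma comp_diff: "comp p (x - y) = comp p x - comp p y"
  using comp_add[of p x "- y"] by (simp add: comp_neg)

section \<open>Homogeneous linear maps and bilinear operations, and the bracket between them\<close>

definition lin :: "bit \<Rightarrow> ('v \<Rightarrow> 'v) \<Rightarrow> bool" where
  "lin p A \<longleftrightarrow> (\<forall>x y. A (x + y) = A x + A y) \<and> (\<forall>c x. A (c *s x) = c *s A x) \<and>
     (\<forall>q. \<forall>x\<in>G q. A x \<in> G (p + q))"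

text \<open>This is membership in \<open>part (bilinear_space space) p\<close>, spelled out as plain
  equations for rewriting; \<open>bilinear_space_space\<close> states the equivalence.\<close>

definition bil :: "bit \<Rightarrow> ('v \<Rightarrow> 'v \<Rightarrow> 'v) \<Rightarrow> bool" where
  "bil p B \<longleftrightarrow> (\<forall>x y z. B (x + y) z = B x z + B y z) \<and> (\<forall>x y z. B x (y + z) = B x y + B x z) \<and>
     (\<forall>c x y. B (c *s x) y = c *s B x y) \<and> (\<forall>c x y. B x (c *s y) = c *s B x y) \<and>
     (\<forall>i j. \<forall>x\<in>G i. \<forall>y\<in>G j. B x y \<in> G (i + j + p))"

lemma lin_add: "lin p A \<Longrightarrow> A (x + y) = A x + A y"
  and lin_scale: "lin p A \<Longrightarrow> A (c *s x) = c *s A x"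
  and lin_G: "lin p A \<Longrightarrow> x \<in> G q \<Longrightarrow> A x \<in> G (p + q)"
  by (auto simp: lin_def)

lemma lin_0: "lin p A \<Longrightarrow> A 0 = 0"
  using lin_scale[of p A 0 0] by simp

lemma lin_neg: "lin p A \<Longrightarrow> A (- x) = - A x"
  using lin_scale[of p A "- 1" x] by simp

lemma lin_diff: "lin p A \<Longrightarrow> A (x - y) = A x - A y"
  using lin_add[of p A x "- y"] lin_neg[of p A y] by simp

lemmas lin_simps = lin_add lin_scale lin_0 lin_neg lin_diff

lemma bil_addl: "bil p B \<Longrightarrow> B (x + y) z = B x z + B y z"
  and bil_addr: "bil p B \<Longrightarrow> B x (y + z) = B x y + B x z"
  and bil_scalel: "bil p B \<Longrightarrow> B (c *s x) y = c *s B x y"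
  and bil_scaler: "bil p B \<Longrightarrow> B x (c *s y) = c *s B x y"
  and bil_G: "bil p B \<Longrightarrow> x \<in> G i \<Longrightarrow> y \<in> G j \<Longrightarrow> B x y \<in> G (i + j + p)"
  by (auto simp: bil_def)

lemma bil_0l: "bil p B \<Longrightarrow> B 0 x = 0"
  and bil_0r: "bil p B \<Longrightarrow> B x 0 = 0"
  using bil_scalel[of p B 0 0 x] bil_scaler[of p B x 0 0] by auto

lemma bil_negl: "bil p B \<Longrightarrow> B (- x) y = - B x y"
  and bil_negr: "bil p B \<Longrightarrow> B x (- y) = - B x y"
  using bil_scalel[of p B "- 1" x y] bil_scaler[of p B x "- 1" y] by auto

lemma bil_diffl: "bil p B \<Longrightarrow> B (x - y) z = B x z - B y z"
  and bil_diffr: "bil p B \<Longrightarrow> B x (y - z) = B x y - B x z"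
  using bil_addl[of p B x "- y" z] bil_addr[of p B x y "- z"] bil_negl[of p B y z] bil_negr[of p B x z]
  by auto

lemmas bil_simps = bil_addl bil_addr bil_scalel bil_scaler bil_0l bil_0r bil_negl bil_negr
  bil_diffl bil_diffr

text \<open>\<open>sg p x\<close> is \<open>(-1)^(p |x|) x\<close>, so that \<open>brk\<close> needs no splitting of \<open>x\<close> into components.\<close>

definition sg :: "bit \<Rightarrow> 'v \<Rightarrow> 'v" where
  "sg p x = comp 0 x + psign p *s comp 1 x"

lemma sg_zero [simp]: "sg 0 x = x"
  by (simp add: sg_def comp_sum)

lemma sg_homogeneous: "x \<in> G q \<Longrightarrow> sg p x = psign (p * q) *s x"
  by (cases p; cases q) (simp_all add: sg_def comp_homogeneous)

lemma sg_add: "sg p (x + y) = sg p x + sg p y"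
  and sg_scale: "sg p (c *s x) = c *s sg p x"
  by (simp_all add: sg_def comp_add comp_scale algebra_simps)

lemma sg_neg: "sg p (- x) = - sg p x"
  and sg_diff: "sg p (x - y) = sg p x - sg p y"
  by (simp_all add: sg_def comp_neg comp_diff algebra_simps)

lemma sg_sg [simp]: "sg p (sg q x) = sg (p + q) x"
proof -
  have "sg p (sg q (comp r x)) = sg (p + q) (comp r x)" for r
    by (cases p; cases q; cases r) (simp_all add: sg_homogeneous[OF comp_in] sg_neg)
  then show ?thesis
    using comp_sum[of x] by (metis sg_add)
qed

text \<open>A map of parity p shifts the parity of its argument by p, so moving \<open>sg q\<close>
  past it costs the sign (-1)^(p q). This sign rule is what \<open>brk_brk\<close> needs.\<close>

lemma lin_sg: "lin p A \<Longrightarrow> sg q (A x) = psign (p * q) *s A (sg q x)"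
proof -
  assume A: "lin p A"
  have "sg q (A (comp r x)) = psign (p * q) *s A (sg q (comp r x))" for r
    using lin_G[OF A comp_in, of r x]
    by (cases p; cases q; cases r) (simp_all add: sg_homogeneous sg_homogeneous[OF comp_in] lin_simps[OF A])
  then have "sg q (A (comp 0 x + comp 1 x)) = psign (p * q) *s A (sg q (comp 0 x + comp 1 x))"
    by (simp add: sg_add lin_simps[OF A] scale_right_distrib)
  then show ?thesis
    by (simp add: comp_sum)
qed

text \<open>The sign (-1)^(p (q + |x|)) of the last term is split into (-1)^(p q) and (-1)^(p |x|),
  and the second factor is absorbed into \<open>sg p x\<close>. The formula is thus meaningful for
  all x at once.\<close>

definition brk :: "bit \<Rightarrow> bit \<Rightarrow> ('v \<Rightarrow> 'v) \<Rightarrow> ('v \<Rightarrow> 'v \<Rightarrow> 'v) \<Rightarrow> 'v \<Rightarrow> 'v \<Rightarrow> 'v" where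
  "brk p q A B x y = A (B x y) - psign (p * q) *s B (A x) y - psign (p * q) *s B (sg p x) (A y)"

lemma bracket_eq_brk:
  assumes "lin p A" "bil q B"
  shows "bracket space p q A B = brk p q A B"
proof (intro ext)
  fix x y
  have "bracket space p q A B x y = brk p q A B (comp 0 x + comp 1 x) y"
    by (cases p; cases q) (simp_all add: bracket_def parity_sum_def hbracket_def brk_def
      lin_simps[OF assms(1)] bil_simps[OF assms(2)] sg_add sg_homogeneous[OF comp_in]
      algebra_simps)
  then show "bracket space p q A B x y = brk p q A B x y"
    by (simp add: comp_sum)
qed

lemma bil_brk:
  assumes A: "lin p A" and B: "bil q B"
  shows "bil (p + q) (brk p q A B)"
proof -
  have "brk p q A B x y \<in> G (i + j + (p + q))" if "x \<in> G i" "y \<in> G j" for x y i j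
  proof -
    have "A (B x y) \<in> G (p + (i + j + q))" "B (A x) y \<in> G (p + i + j + q)" "B x (A y) \<in> G (i + (p + j) + q)"
      using lin_G[OF A] bil_G[OF B] that by simp_all
    then show ?thesis
      unfolding brk_def sg_homogeneous[OF \<open>x \<in> G i\<close>] bil_simps[OF B]
      by (intro G_intros) (simp_all add: ac_simps)
  qed
  then show ?thesis
    unfolding bil_def
    by (simp add: brk_def lin_simps[OF A] bil_simps[OF B] sg_add sg_scale algebra_simps
        scale_right_distrib scale_left_commute)
qed

text \<open>Linear operators form a Lie superalgebra acting on bilinear operations, and this is the
  module axiom; the abstraction on the right is the supercommutator of A and B. Once the three
  parities are fixed, every sign is a number and the mixed terms cancel.\<close>

lemma brk_brk:
  assumes A: "lin p A" and B: "lin q B" and C: "bil r C"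
  shows "brk p (q + r) A (brk q r B C) x y - psign (p * q) *s brk q (p + r) B (brk p r A C) x y =
    brk (p + q) r (\<lambda>z. A (B z) - psign (p * q) *s B (A z)) C x y"
  by (cases p; cases q; cases r)
    (simp_all add: brk_def lin_simps[OF A] lin_simps[OF B] bil_simps[OF C]
      lin_sg[OF A] lin_sg[OF B] algebra_simps)

end

subsection \<open>Superspaces with a carrier\<close>

locale carrier_superspace =
  fixes S :: "('f::field, 'w) sspace"
  assumes is_superspace: "is_superspace S"
begin

lemma add_closed [simp]: "x \<in> carr S \<Longrightarrow> y \<in> carr S \<Longrightarrow> add S x y \<in> carr S"
  and scl_closed [simp]: "x \<in> carr S \<Longrightarrow> scl S c x \<in> carr S"
  and zer_closed [simp]: "zer S \<in> carr S"
  and add_assoc: "x \<in> carr S \<Longrightarrow> y \<in> carr S \<Longrightarrow> z \<in> carr S \<Longrightarrow> add S (add S x y) z = add S x (add S y z)"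
  and add_commute: "x \<in> carr S \<Longrightarrow> y \<in> carr S \<Longrightarrow> add S x y = add S y x"
  and add_zer [simp]: "x \<in> carr S \<Longrightarrow> add S x (zer S) = x"
  and add_neg: "x \<in> carr S \<Longrightarrow> add S x (neg S x) = zer S"
  and scl_add: "x \<in> carr S \<Longrightarrow> y \<in> carr S \<Longrightarrow> scl S c (add S x y) = add S (scl S c x) (scl S c y)"
  and add_scl: "x \<in> carr S \<Longrightarrow> scl S (c + d) x = add S (scl S c x) (scl S d x)"
  and scl_scl: "x \<in> carr S \<Longrightarrow> scl S c (scl S d x) = scl S (c * d) x"
  and scl_one [simp]: "x \<in> carr S \<Longrightarrow> scl S 1 x = x"
  and subspace_of_part: "subspace_of S (part S p)"
  and decomposition: "x \<in> carr S \<Longrightarrow> \<exists>!y. y \<in> part S 0 \<and> (\<exists>z\<in>part S 1. x = add S y z)"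
proof -
  note S = is_superspace[unfolded is_superspace_def]
  note carr = S[THEN conjunct1, unfolded subspace_of_def]
  show "x \<in> carr S \<Longrightarrow> y \<in> carr S \<Longrightarrow> add S x y \<in> carr S" "x \<in> carr S \<Longrightarrow> scl S c x \<in> carr S"
    "zer S \<in> carr S"
    using carr by auto
  note S = S[THEN conjunct2]
  show "x \<in> carr S \<Longrightarrow> y \<in> carr S \<Longrightarrow> z \<in> carr S \<Longrightarrow> add S (add S x y) z = add S x (add S y z)"
    by (rule S[THEN conjunct1, rule_format])
  note S = S[THEN conjunct2]
  show "x \<in> carr S \<Longrightarrow> y \<in> carr S \<Longrightarrow> add S x y = add S y x"
    by (rule S[THEN conjunct1, rule_format])
  note S = S[THEN conjunct2]
  show "x \<in> carr S \<Longrightarrow> add S x (zer S) = x" "x \<in> carr S \<Longrightarrow> add S x (neg S x) = zer S"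
    using S[THEN conjunct1] by auto
  note S = S[THEN conjunct2]
  show "x \<in> carr S \<Longrightarrow> y \<in> carr S \<Longrightarrow> scl S c (add S x y) = add S (scl S c x) (scl S c y)"
    by (rule S[THEN conjunct1, rule_format])
  note S = S[THEN conjunct2]
  show "x \<in> carr S \<Longrightarrow> scl S (c + d) x = add S (scl S c x) (scl S d x)"
    by (rule S[THEN conjunct1, rule_format])
  note S = S[THEN conjunct2]
  show "x \<in> carr S \<Longrightarrow> scl S c (scl S d x) = scl S (c * d) x"
    by (rule S[THEN conjunct1, rule_format, symmetric])
  note S = S[THEN conjunct2]
  show "x \<in> carr S \<Longrightarrow> scl S 1 x = x"
    by (rule S[THEN conjunct1, rule_format])
  note S = S[THEN conjunct2]
  show "subspace_of S (part S p)"
    by (rule S[THEN conjunct1, rule_format])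
  show "x \<in> carr S \<Longrightarrow> \<exists>!y. y \<in> part S 0 \<and> (\<exists>z\<in>part S 1. x = add S y z)"
    using S[THEN conjunct2] by auto
qed

lemma part_carr: "x \<in> part S p \<Longrightarrow> x \<in> carr S"
  and part_zer [simp]: "zer S \<in> part S p"
  and part_add: "x \<in> part S p \<Longrightarrow> y \<in> part S p \<Longrightarrow> add S x y \<in> part S p"
  and part_scl: "x \<in> part S p \<Longrightarrow> scl S c x \<in> part S p"
  using subspace_of_part unfolding subspace_of_def by blast+

lemma neg_closed [simp]: "x \<in> carr S \<Longrightarrow> neg S x \<in> carr S"
  and part_neg: "x \<in> part S p \<Longrightarrow> neg S x \<in> part S p"
  by (simp_all add: neg_def part_scl)

lemma sub_closed [simp]: "x \<in> carr S \<Longrightarrow> y \<in> carr S \<Longrightarrow> sub S x y \<in> carr S"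
  by (simp add: sub_def)

lemma zer_add [simp]: "x \<in> carr S \<Longrightarrow> add S (zer S) x = x"
  using add_commute by fastforce

lemma add_swap:
  assumes "a \<in> carr S" "b \<in> carr S" "c \<in> carr S" "d \<in> carr S"
  shows "add S (add S a b) (add S c d) = add S (add S a c) (add S b d)"
  using assms add_commute[of b c] by (simp add: add_assoc) (simp flip: add_assoc)

lemma add_cancel_right:
  assumes "x \<in> carr S" "y \<in> carr S" "z \<in> carr S" "add S x z = add S y z"
  shows "x = y"
proof -
  have "x = add S (add S x z) (neg S z)" "y = add S (add S y z) (neg S z)"
    using assms(1-3) by (simp_all add: add_assoc add_neg)
  then show ?thesis
    using assms(4) by simp
qed

lemma sub_eq_zer: "x \<in> carr S \<Longrightarrow> y \<in> carr S \<Longrightarrow> sub S x y = zer S \<Longrightarrow> x = y"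
  unfolding sub_def using add_cancel_right[of x y "neg S y"] by (simp add: add_neg)

lemma scl_0 [simp]: "x \<in> carr S \<Longrightarrow> scl S 0 x = zer S"
  using add_cancel_right[of "scl S 0 x" "zer S" "scl S 0 x"] add_scl[of x 0 0] by simp

lemma scl_zer [simp]: "scl S c (zer S) = zer S"
  using scl_scl[of "zer S" c 0] by simp

lemma decomposition_unique:
  assumes "y \<in> part S 0" "z \<in> part S 1" "y' \<in> part S 0" "z' \<in> part S 1" "add S y z = add S y' z'"
  shows "y = y'"
  using ex1E[OF decomposition[of "add S y z"]] assms part_carr add_closed by (metis (no_types, lifting))

lemma component_unique:
  assumes "y \<in> part S p" "z \<in> part S (p + 1)"
  shows "component S p (add S y z) = y"
  unfolding component_def
proof (rule the_equality)
  show "y \<in> part S p \<and> (\<exists>w\<in>part S (p + 1). add S y z = add S y w)"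
    using assms by blast
  fix y' assume y': "y' \<in> part S p \<and> (\<exists>w\<in>part S (p + 1). add S y z = add S y' w)"
  from conjunct2[OF y'] obtain w where "w \<in> part S (p + 1)" "add S y z = add S y' w" ..
  note w = conjunct1[OF y'] this
  note c = part_carr[OF assms(1)] part_carr[OF assms(2)] part_carr[OF w(1)] part_carr[OF w(2)]
  show "y' = y"
  proof (cases p)
    case zero
    then show ?thesis
      using decomposition_unique[of y' w y z] assms w by simp
  next
    case one
    have "add S z y = add S w y'"
      using w(3) c add_commute[of y z] add_commute[of y' w] by simp
    then have "z = w"
      using decomposition_unique[of z y w y'] assms w one by simp
    then show ?thesis
      using add_cancel_right[of y' y w] w c by simp
  qed
qed

lemma component_in: "x \<in> carr S \<Longrightarrow> component S p x \<in> part S p"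
  and component_sum: "x \<in> carr S \<Longrightarrow> add S (component S 0 x) (component S 1 x) = x"
proof -
  assume "x \<in> carr S"
  then obtain y z where yz: "y \<in> part S 0" "z \<in> part S 1" "x = add S y z"
    using decomposition by blast
  have "component S 0 x = y" using component_unique[of y 0 z] yz by simp
  moreover have "component S 1 x = z"
    using component_unique[of z 1 y] yz add_commute[of y z] by (simp add: part_carr)
  ultimately show "component S p x \<in> part S p" "add S (component S 0 x) (component S 1 x) = x"
    using yz by (cases p; simp)+
qed

lemma component_closed [simp]: "x \<in> carr S \<Longrightarrow> component S p x \<in> carr S"
  using component_in part_carr by blast

lemma component_sum': "x \<in> carr S \<Longrightarrow> add S (component S p x) (component S (p + 1) x) = x"
  using component_sum[of x] by (cases p) (auto simp: add_commute)

lemma bilinear_ops_closed: "B \<in> bilinear_ops S \<Longrightarrow> x \<in> carr S \<Longrightarrow> y \<in> carr S \<Longrightarrow> B x y \<in> carr S"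
  by (auto simp: bilinear_ops_def)

lemma bilinear_ops_addl:
    "B \<in> bilinear_ops S \<Longrightarrow> x \<in> carr S \<Longrightarrow> y \<in> carr S \<Longrightarrow> z \<in> carr S \<Longrightarrow>
      B (add S x y) z = add S (B x z) (B y z)"
  and bilinear_ops_addr:
    "B \<in> bilinear_ops S \<Longrightarrow> x \<in> carr S \<Longrightarrow> y \<in> carr S \<Longrightarrow> z \<in> carr S \<Longrightarrow>
      B x (add S y z) = add S (B x y) (B x z)"
  and bilinear_ops_scll:
    "B \<in> bilinear_ops S \<Longrightarrow> x \<in> carr S \<Longrightarrow> y \<in> carr S \<Longrightarrow> B (scl S c x) y = scl S c (B x y)"
  and bilinear_ops_sclr:
    "B \<in> bilinear_ops S \<Longrightarrow> x \<in> carr S \<Longrightarrow> y \<in> carr S \<Longrightarrow> B x (scl S c y) = scl S c (B x y)"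
  by (auto simp: bilinear_ops_def linear_on_def)

lemma bilinear_ops_zerl: "B \<in> bilinear_ops S \<Longrightarrow> y \<in> carr S \<Longrightarrow> B (zer S) y = zer S"
  and bilinear_ops_zerr: "B \<in> bilinear_ops S \<Longrightarrow> y \<in> carr S \<Longrightarrow> B y (zer S) = zer S"
  using bilinear_ops_scll[of B "zer S" y 0] bilinear_ops_sclr[of B y "zer S" 0]
  by (simp_all add: bilinear_ops_closed)

text \<open>Both arguments are sums of their homogeneous components, and outside the carrier the two
  operations agree because they are extensional.\<close>

lemma bilinear_ops_eqI:
  assumes A: "A \<in> bilinear_ops S" and B: "B \<in> bilinear_ops S"
    and eq: "\<And>i j x y. x \<in> part S i \<Longrightarrow> y \<in> part S j \<Longrightarrow> A x y = B x y"
  shows "A = B"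
proof -
  have *: "A x y = B x y" if "x \<in> carr S" "y \<in> carr S" for x y
  proof -
    have "A x (add S (component S 0 y) (component S 1 y)) = B x (add S (component S 0 y) (component S 1 y))"
      if "x \<in> part S i" for x i
      using that \<open>y \<in> carr S\<close> eq[OF _ component_in]
      by (simp add: bilinear_ops_addr[OF A] bilinear_ops_addr[OF B] part_carr)
    then have "A x y = B x y" if "x \<in> part S i" for x i
      using that \<open>y \<in> carr S\<close> by (simp add: component_sum)
    then have "A (component S p x) y = B (component S p x) y" for p
      using component_in[OF \<open>x \<in> carr S\<close>] .
    then have "A (add S (component S 0 x) (component S 1 x)) y = B (add S (component S 0 x) (component S 1 x)) y"
      using that by (simp add: bilinear_ops_addl[OF A] bilinear_ops_addl[OF B])
    then show ?thesis
      using that by (simp add: component_sum)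
  qed
  have ext: "A \<in> carr S \<rightarrow>\<^sub>E (carr S \<rightarrow>\<^sub>E carr S)" "B \<in> carr S \<rightarrow>\<^sub>E (carr S \<rightarrow>\<^sub>E carr S)"
    using A B by (auto simp: bilinear_ops_def)
  show ?thesis
  proof (rule PiE_ext[OF ext])
    fix x assume "x \<in> carr S"
    then show "A x = B x"
      using * ext by (intro PiE_ext[of _ "carr S" "\<lambda>_. carr S"]) (auto simp: PiE_mem)
  qed
qed

text \<open>It has not been established that \<open>bilinear_space S\<close> is a superspace, so
  \<open>component_unique\<close> cannot be applied to it. Uniqueness is instead checked at
  homogeneous arguments, where it becomes uniqueness of components in S.\<close>

lemma component_bilinear_space:
  assumes Y: "Y \<in> part (bilinear_space S) p" and Z: "Z \<in> part (bilinear_space S) (p + 1)"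
  shows "component (bilinear_space S) p (add (bilinear_space S) Y Z) = Y"
  unfolding component_def
proof (rule the_equality)
  show "Y \<in> part (bilinear_space S) p \<and>
      (\<exists>W\<in>part (bilinear_space S) (p + 1). add (bilinear_space S) Y Z = add (bilinear_space S) Y W)"
    using assms by blast
  fix Y' assume "Y' \<in> part (bilinear_space S) p \<and>
      (\<exists>W\<in>part (bilinear_space S) (p + 1). add (bilinear_space S) Y Z = add (bilinear_space S) Y' W)"
  then obtain Z' where Y': "Y' \<in> part (bilinear_space S) p" and Z': "Z' \<in> part (bilinear_space S) (p + 1)"
    and eq: "add (bilinear_space S) Y Z = add (bilinear_space S) Y' Z'" by blast
  show "Y' = Y"
  proof (rule bilinear_ops_eqI)
    show "Y' \<in> bilinear_ops S" "Y \<in> bilinear_ops S"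
      using Y Y' by (auto simp: bilinear_space_def)
    fix i j x y assume xy: "x \<in> part S i" "y \<in> part S j"
    have "add S (Y x y) (Z x y) = add S (Y' x y) (Z' x y)"
      using fun_cong[OF fun_cong[OF eq], of x y] xy by (simp add: bilinear_space_def part_carr)
    moreover have "Y x y \<in> part S (i + j + p)" "Y' x y \<in> part S (i + j + p)"
      "Z x y \<in> part S (i + j + p + 1)" "Z' x y \<in> part S (i + j + p + 1)"
      using Y Z Y' Z' xy by (auto simp: bilinear_space_def add.assoc)
    ultimately show "Y' x y = Y x y"
      using component_unique by metis
  qed
qed

end

text \<open>\<open>\<Phi>\<close> embeds \<open>W\<close> into the bilinear operations on \<open>V\<close> by \<open>\<alpha> \<mapsto> [L\<^sub>\<alpha>, M]\<close> and \<open>\<epsilon> \<mapsto> - M\<close>. The last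
  assumption says that \<open>ad a\<close> becomes \<open>(A, B) \<mapsto> \<plusminus>[A(a, -), B]\<close> under this embedding.\<close>

locale adjoint_rep = superspace scale G + carrier_superspace S
  for scale :: "'f::field \<Rightarrow> 'v::ab_group_add \<Rightarrow> 'v" (infixr "*s" 75)
    and G :: "bit \<Rightarrow> 'v set"
    and S :: "('f, 'w) sspace" +
  fixes M :: "'v \<Rightarrow> 'v \<Rightarrow> 'v"
    and \<Phi> :: "'w \<Rightarrow> 'v \<Rightarrow> 'v \<Rightarrow> 'v"
    and \<epsilon> :: 'w
    and ad :: "'v \<Rightarrow> 'w \<Rightarrow> 'w \<Rightarrow> 'w"
  assumes bil_M: "bil 0 M"
    and Phi_add: "x \<in> carr S \<Longrightarrow> y \<in> carr S \<Longrightarrow> \<Phi> (add S x y) u v = \<Phi> x u v + \<Phi> y u v"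
    and Phi_scl: "x \<in> carr S \<Longrightarrow> \<Phi> (scl S c x) u v = c *s \<Phi> x u v"
    and Phi_inj: "x \<in> carr S \<Longrightarrow> (\<And>u v. \<Phi> x u v = 0) \<Longrightarrow> x = zer S"
    and Phi_bil: "x \<in> part S p \<Longrightarrow> bil p (\<Phi> x)"
    and eps_part: "\<epsilon> \<in> part S 0"
    and Phi_eps: "\<Phi> \<epsilon> u v = - M u v"
    and Phi_span: "x \<in> part S p \<Longrightarrow>
      \<exists>a\<in>G p. \<exists>s. (p \<noteq> 0 \<longrightarrow> s = 0) \<and> (\<forall>u v. \<Phi> x u v = brk p 0 (M a) M u v - s *s M u v)"
    and ad_linear: "linear_on space (bilinear_space S) ad"
    and Phi_ad: "a \<in> G i \<Longrightarrow> x \<in> part S j \<Longrightarrow> y \<in> part S k \<Longrightarrow>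
      \<Phi> (ad a x y) u v = psign (i * j) *s brk (i + j) k (\<Phi> x a) (\<Phi> y) u v"
begin

end

subsection \<open>Abstract adjoint representations\<close>

context superspace
begin

lemma brk_scaleB: "lin p A \<Longrightarrow> brk p q A (\<lambda>u v. c *s B u v) x y = c *s brk p q A B x y"
  by (simp add: brk_def lin_simps algebra_simps scale_left_commute)

lemma brk_addA: "bil q B \<Longrightarrow>
    brk p q (\<lambda>z. A z + c *s A' z) B x y = brk p q A B x y + c *s brk p q A' B x y"
  by (simp add: brk_def bil_simps algebra_simps scale_left_commute)

lemma brk_diffA: "bil q B \<Longrightarrow> brk p q (\<lambda>z. A z - A' z) B x y = brk p q A B x y - brk p q A' B x y"
  by (simp add: brk_def bil_simps algebra_simps)

lemma brk_diffB: "lin p A \<Longrightarrow> brk p q A (\<lambda>u v. B u v - B' u v) x y = brk p q A B x y - brk p q A B' x y"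
  by (simp add: brk_def lin_simps algebra_simps)

lemma brk_0A: "bil q B \<Longrightarrow> brk p q (\<lambda>z. 0) B x y = 0"
  by (simp add: brk_def bil_simps)

lemma brk_0B: "lin p A \<Longrightarrow> brk p q A (\<lambda>u v. 0) x y = 0"
  by (simp add: brk_def lin_simps)

lemma lin_bil: "bil r B \<Longrightarrow> a \<in> G i \<Longrightarrow> lin (i + r) (B a)"
  using bil_G[of r B a i] by (auto simp: lin_def bil_simps ac_simps)

text \<open>At homogeneous arguments the value lies in two different parts, whose intersection is
  zero. The lemma serves to separate the even and the odd half of an identity between
  operations.\<close>

lemma bil_eq_zero:
  assumes "bil p B" "bil q B" "p \<noteq> q"
  shows "B x y = 0"
proof -
  have "B (comp i x) (comp j y) = 0" for i j
    using bil_G[OF assms(1) comp_in comp_in, of i x j y] bil_G[OF assms(2) comp_in comp_in, of i x j y] assms(3)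
    by (intro G_Int'[of _ "i + j + p" "i + j + q"]) simp_all
  then have "B (comp 0 x + comp 1 x) (comp 0 y + comp 1 y) = 0"
    by (simp add: bil_simps[OF assms(1)])
  then show ?thesis by (simp add: comp_sum)
qed

text \<open>The identity behind the homomorphism property: \<open>[L\<^sub>a, X]\<^sub>b\<close> differs from \<open>[L\<^sub>a, X\<^sub>b]\<close> by
  \<open>X\<close> evaluated at \<open>ab\<close>.\<close>

lemma brk_transport:
  assumes M: "bil 0 M" and X: "bil r X" and Y: "bil k Y" and a: "a \<in> G i" and b: "b \<in> G j"
  shows "brk i (j + r + k) (M a) (brk (j + r) k (X b) Y) u v
    - psign (i * (j + r)) *s brk (j + r) (i + k) (X b) (brk i k (M a) Y) u v
    - brk (i + j + r) k (brk i r (M a) X b) Y u v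
    = psign (i * r) *s brk (i + j + r) k (X (M a b)) Y u v"
proof -
  have La: "lin i (M a)" using lin_bil[OF M a] by simp
  have Xb: "lin (j + r) (X b)" using lin_bil[OF X b] .
  have "(\<lambda>z. M a (X b z) - psign (i * (j + r)) *s X b (M a z)) =
      (\<lambda>z. brk i r (M a) X b z + psign (i * r) *s X (M a b) z)"
    by (cases i; cases j; cases r) (simp_all add: brk_def sg_homogeneous[OF b] bil_simps[OF X] fun_eq_iff)
  then show ?thesis
    using brk_brk[OF La Xb Y, of u v] brk_addA[OF Y, of "i + (j + r)" "brk i r (M a) X b" "psign (i * r)" "X (M a b)" u v]
    by (simp add: add.assoc)
qed

lemma superderivation_iff_brk:
  assumes M: "bil 0 M" and a: "a \<in> G p"
  shows "superderivation M p (M a) \<longleftrightarrow> (\<forall>x y. brk p 0 (M a) M x y = 0)"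
proof
  have lin: "lin p (M a)" using lin_bil[OF M a] by simp
  assume "superderivation M p (M a)"
  then have "M a (M (comp r x) y) = M (M a (comp r x)) y + psign (p * r) *s M (comp r x) (M a y)" for r x y
    using comp_in unfolding superderivation_def by blast
  then have *: "brk p 0 (M a) M (comp r x) y = 0" for r x y
    by (simp add: brk_def sg_homogeneous[OF comp_in] bil_simps[OF M])
  have "brk p 0 (M a) M (comp 0 x + comp 1 x) y = 0" for x y
    using * bil_brk[OF lin M] by (simp only: bil_addl) simp
  then show "\<forall>x y. brk p 0 (M a) M x y = 0"
    by (simp add: comp_sum)
next
  assume *: "\<forall>x y. brk p 0 (M a) M x y = 0"
  show "superderivation M p (M a)"
    unfolding superderivation_def
  proof (intro allI ballI)
    fix r x y assume "x \<in> G r"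
    then show "M a (M x y) = M (M a x) y + psign (p * r) *s M x (M a y)"
      using *[rule_format, of x y] by (simp add: brk_def sg_homogeneous bil_simps[OF M] algebra_simps)
  qed
qed

lemma jacobi_space_iff:
  assumes "bil 0 M"
  shows "a \<in> jacobi_space M \<longleftrightarrow> (\<forall>p x y. brk p 0 (M (comp p a)) M x y = 0)"
  using superderivation_iff_brk[OF assms comp_in] by (auto simp: jacobi_space_def)

end

context adjoint_rep
begin

section \<open>Linearity and parity of \<open>ad\<close>, read off from
  \<open>\<Phi>\<close>\<close>

lemma Phi_zer: "\<Phi> (zer S) u v = 0"
  using Phi_scl[of "zer S" 0 u v] by simp

lemma Phi_neg: "x \<in> carr S \<Longrightarrow> \<Phi> (neg S x) u v = - \<Phi> x u v"
  by (simp add: neg_def Phi_scl)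

lemma Phi_sub: "x \<in> carr S \<Longrightarrow> y \<in> carr S \<Longrightarrow> \<Phi> (sub S x y) u v = \<Phi> x u v - \<Phi> y u v"
  by (simp add: sub_def Phi_add Phi_neg)

lemmas Phi_simps = Phi_add Phi_scl Phi_zer Phi_neg Phi_sub

lemma Phi_eqI: "x \<in> carr S \<Longrightarrow> y \<in> carr S \<Longrightarrow> (\<And>u v. \<Phi> x u v = \<Phi> y u v) \<Longrightarrow> x = y"
  by (rule sub_eq_zer) (simp_all add: Phi_inj[OF sub_closed] Phi_sub)

text \<open>Parity is reflected by \<Phi>: the image of the wrong component of x has parity p as a
  difference and parity p + 1 by itself, hence vanishes, and \<Phi> is injective. The parity of the
  values of \<open>ad\<close> is obtained in this way from that of a bracket.\<close>

lemma part_if_bil_Phi: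
  assumes x: "x \<in> carr S" and bil: "bil p (\<Phi> x)"
  shows "x \<in> part S p"
proof -
  let ?y = "component S p x" and ?z = "component S (p + 1) x"
  have yz: "bil p (\<Phi> ?y)" "bil (p + 1) (\<Phi> ?z)"
    using component_in[OF x] Phi_bil by auto
  have "\<Phi> x u v = \<Phi> ?y u v + \<Phi> ?z u v" for u v
    using Phi_add[OF component_closed component_closed, OF x x, of p "p + 1" u v]
    by (simp only: component_sum'[OF x])
  then have *: "\<Phi> ?z = (\<lambda>u v. \<Phi> x u v - \<Phi> ?y u v)"
    by (intro ext) simp
  have "bil p (\<Phi> ?z)"
    unfolding * using bil yz(1) by (auto simp: bil_def algebra_simps G_diff)
  then have "?z = zer S"
    using bil_eq_zero[OF yz(2), of p] Phi_inj[OF component_closed[OF x]] by simp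
  then show ?thesis
    using component_sum'[OF x, of p] component_in[OF x, of p] by (metis add_zer part_carr)
qed

lemma bilinear_space_simps:
  "carr (bilinear_space S) = bilinear_ops S"
  "x \<in> carr S \<Longrightarrow> y \<in> carr S \<Longrightarrow> add (bilinear_space S) A B x y = add S (A x y) (B x y)"
  "x \<in> carr S \<Longrightarrow> y \<in> carr S \<Longrightarrow> scl (bilinear_space S) c A x y = scl S c (A x y)"
  "x \<in> carr S \<Longrightarrow> y \<in> carr S \<Longrightarrow> zer (bilinear_space S) x y = zer S"
  by (simp_all add: bilinear_space_def)

lemma ad_in: "ad a \<in> bilinear_ops S"
  using ad_linear by (auto simp: linear_on_def bilinear_space_simps)

lemma ad_closed [simp]: "x \<in> carr S \<Longrightarrow> y \<in> carr S \<Longrightarrow> ad a x y \<in> carr S"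
  using ad_in bilinear_ops_closed by blast

lemma ad_add: "ad (a + b) = add (bilinear_space S) (ad a) (ad b)"
  using ad_linear by (auto simp: linear_on_def)

lemma ad_add_apply: "x \<in> carr S \<Longrightarrow> y \<in> carr S \<Longrightarrow> ad (a + b) x y = add S (ad a x y) (ad b x y)"
  by (simp add: ad_add bilinear_space_simps)

lemma ad_scale_apply: "x \<in> carr S \<Longrightarrow> y \<in> carr S \<Longrightarrow> ad (c *s a) x y = scl S c (ad a x y)"
  using ad_linear by (auto simp: linear_on_def bilinear_space_simps)

lemmas ad_addl = bilinear_ops_addl[OF ad_in]
  and ad_addr = bilinear_ops_addr[OF ad_in]
  and ad_zerl = bilinear_ops_zerl[OF ad_in]
  and ad_zerr = bilinear_ops_zerr[OF ad_in]

lemma lin_left_mult: "a \<in> G i \<Longrightarrow> lin i (M a)"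
  using lin_bil[OF bil_M, of a i] by simp

lemma Phi_lin: "a \<in> G i \<Longrightarrow> x \<in> part S j \<Longrightarrow> lin (i + j) (\<Phi> x a)"
  by (rule lin_bil[OF Phi_bil])

lemma bil_scale: "bil p B \<Longrightarrow> bil p (\<lambda>u v. c *s B u v)"
  unfolding bil_def by (simp add: algebra_simps G_scale scale_left_commute)

lemma Phi_ad_fun: "a \<in> G i \<Longrightarrow> x \<in> part S j \<Longrightarrow> y \<in> part S k \<Longrightarrow>
    \<Phi> (ad a x y) = (\<lambda>u v. psign (i * j) *s brk (i + j) k (\<Phi> x a) (\<Phi> y) u v)"
  by (intro ext) (rule Phi_ad)

lemma ad_part_apply:
  assumes "a \<in> G i" "x \<in> part S j" "y \<in> part S k"
  shows "ad a x y \<in> part S (i + j + k)"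
proof (rule part_if_bil_Phi)
  show "ad a x y \<in> carr S" using assms part_carr by simp
  show "bil (i + j + k) (\<Phi> (ad a x y))"
    unfolding Phi_ad_fun[OF assms]
    by (intro bil_scale bil_brk Phi_lin Phi_bil assms)
qed

lemma ad_part: "a \<in> G i \<Longrightarrow> ad a \<in> part (bilinear_space S) i"
  using ad_in ad_part_apply[of a i] by (auto simp: bilinear_space_def ac_simps)

text \<open>\<open>triangle\<close> splits its operands into components; since \<open>ad\<close> is
  even and additive, the splitting can be carried out on the element a instead.\<close>

lemma component_ad: "component (bilinear_space S) p (ad a) = ad (comp p a)"
  using component_bilinear_space[OF ad_part ad_part, of "comp p a" p "comp (p + 1) a"]
  by (simp flip: ad_add add: comp_sum')

section \<open>The homomorphism property\<close>

lemma Phi_ad_neg_eps: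
  assumes "a \<in> G i" "y \<in> part S k"
  shows "\<Phi> (ad a (neg S \<epsilon>) y) = brk i k (M a) (\<Phi> y)"
proof -
  have "\<Phi> (neg S \<epsilon>) a = M a"
    using eps_part by (auto simp: Phi_neg Phi_eps part_carr)
  then show ?thesis
    using Phi_ad_fun[OF assms(1) part_neg[OF eps_part] assms(2)] by simp
qed

lemma ad_neg_eps_part: "a \<in> G i \<Longrightarrow> y \<in> part S k \<Longrightarrow> ad a (neg S \<epsilon>) y \<in> part S (i + k)"
  using ad_part_apply[OF _ part_neg[OF eps_part]] by fastforce

text \<open>Under the injective map \<Phi> the three summands of \<open>hbracket\<close> become, up
  to sign, the three terms on the left of \<open>brk_transport\<close> with X = \<Phi> x and Y =
  \<Phi> y, and the right side becomes the term with X evaluated at the product of a and b.\<close>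

lemma hbracket_ad_homogeneous:
  assumes a: "a \<in> G i" and b: "b \<in> G j" and x: "x \<in> part S r" and y: "y \<in> part S k"
  shows "hbracket S i j r (ad a (neg S \<epsilon>)) (ad b) x y = ad (M a b) x y"
proof (rule Phi_eqI)
  note c = part_carr[OF eps_part] part_carr[OF x] part_carr[OF y]
  show "hbracket S i j r (ad a (neg S \<epsilon>)) (ad b) x y \<in> carr S" "ad (M a b) x y \<in> carr S"
    using c by (simp_all add: hbracket_def)
  fix u v
  note X = Phi_bil[OF x] and Y = Phi_bil[OF y]
  have Mab: "M a b \<in> G (i + j)" using bil_G[OF bil_M a b] by simp
  have 1: "\<Phi> (ad a (neg S \<epsilon>) (ad b x y)) u v =
      psign (j * r) *s brk i (j + r + k) (M a) (brk (j + r) k (\<Phi> x b) (\<Phi> y)) u v"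
    unfolding Phi_ad_neg_eps[OF a ad_part_apply[OF b x y]] Phi_ad_fun[OF b x y]
    by (rule brk_scaleB[OF lin_left_mult[OF a]])
  have 2: "\<Phi> (ad b (ad a (neg S \<epsilon>) x) y) u v =
      psign (j * (i + r)) *s brk (i + j + r) k (brk i r (M a) (\<Phi> x) b) (\<Phi> y) u v"
    unfolding Phi_ad_fun[OF b ad_neg_eps_part[OF a x] y] Phi_ad_neg_eps[OF a x]
    by (simp add: ac_simps)
  have 3: "\<Phi> (ad b x (ad a (neg S \<epsilon>) y)) u v =
      psign (j * r) *s brk (j + r) (i + k) (\<Phi> x b) (brk i k (M a) (\<Phi> y)) u v"
    unfolding Phi_ad_fun[OF b x ad_neg_eps_part[OF a y]] Phi_ad_neg_eps[OF a y] ..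
  have 4: "\<Phi> (ad (M a b) x y) u v = psign ((i + j) * r) *s brk (i + j + r) k (\<Phi> x (M a b)) (\<Phi> y) u v"
    unfolding Phi_ad_fun[OF Mab x y] ..
  \<comment> \<open>The product of a and b has parity i + j, so its sign from \<open>Phi_ad\<close>
    factors into (-1)^(j r), common to all terms, and (-1)^(i r), the sign in
    \<open>brk_transport\<close>.\<close>
  have "psign (j * r) *s (psign (i * r) *s brk (i + j + r) k (\<Phi> x (M a b)) (\<Phi> y) u v) =
      \<Phi> (ad (M a b) x y) u v"
    unfolding 4 by (cases i; cases j; cases r) simp_all
  then have "\<Phi> (ad (M a b) x y) u v = psign (j * r) *s (
     brk i (j + r + k) (M a) (brk (j + r) k (\<Phi> x b) (\<Phi> y)) u v
    - psign (i * (j + r)) *s brk (j + r) (i + k) (\<Phi> x b) (brk i k (M a) (\<Phi> y)) u v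
    - brk (i + j + r) k (brk i r (M a) (\<Phi> x) b) (\<Phi> y) u v)"
    unfolding brk_transport[OF bil_M X Y a b] by simp
  also have "\<dots> = \<Phi> (ad a (neg S \<epsilon>) (ad b x y)) u v
      - psign (i * j) *s \<Phi> (ad b (ad a (neg S \<epsilon>) x) y) u v
      - psign (i * (j + r)) *s \<Phi> (ad b x (ad a (neg S \<epsilon>) y)) u v"
    unfolding 1 2 3 by (cases i; cases j; cases r) simp_all
  also have "\<dots> = \<Phi> (hbracket S i j r (ad a (neg S \<epsilon>)) (ad b) x y) u v"
    using c by (simp add: hbracket_def Phi_simps)
  finally show "\<Phi> (hbracket S i j r (ad a (neg S \<epsilon>)) (ad b) x y) u v = \<Phi> (ad (M a b) x y) u v" ..
qed

text \<open>\<open>bracket\<close> decomposes only its first argument, so the passage to an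
  arbitrary second argument needs its own linear extension.\<close>

lemma hbracket_ad:
  assumes a: "a \<in> G i" and b: "b \<in> G j" and x: "x \<in> part S r" and y: "y \<in> carr S"
  shows "hbracket S i j r (ad a (neg S \<epsilon>)) (ad b) x y = ad (M a b) x y"
proof -
  let ?H = "\<lambda>y. hbracket S i j r (ad a (neg S \<epsilon>)) (ad b) x y"
  note c = part_carr[OF eps_part] part_carr[OF x] y
  have "?H (add S (component S 0 y) (component S 1 y)) =
      add S (?H (component S 0 y)) (?H (component S 1 y))"
    \<comment> \<open>The summands are rearranged after applying \<Phi>, where addition is that of
      the type \<open>'v\<close> and \<open>algebra_simps\<close> works.\<close>
    by (rule Phi_eqI) (use c in \<open>simp_all add: hbracket_def Phi_simps ad_addr algebra_simps\<close>)
  also have "\<dots> = ad (M a b) x (add S (component S 0 y) (component S 1 y))"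
    using c by (simp add: hbracket_ad_homogeneous[OF a b x component_in] ad_addr)
  finally show ?thesis using y by (simp add: component_sum)
qed

lemma M_components: "(M (comp 0 a) (comp 0 b) + M (comp 0 a) (comp 1 b)) +
    (M (comp 1 a) (comp 0 b) + M (comp 1 a) (comp 1 b)) = M a b"
proof -
  have "M a b = M (comp 0 a + comp 1 a) (comp 0 b + comp 1 b)" by (simp add: comp_sum)
  then show ?thesis by (simp add: bil_simps[OF bil_M])
qed

lemma triangle_ad:
  assumes "x \<in> carr S" "y \<in> carr S"
  shows "triangle S (neg S \<epsilon>) (ad a) (ad b) x y = ad (M a b) x y"
proof -
  have "bracket S p q (ad (comp p a) (neg S \<epsilon>)) (ad (comp q b)) x y = ad (M (comp p a) (comp q b)) x y" for p q
    using assms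
    by (simp add: bracket_def parity_sum_def hbracket_ad[OF comp_in comp_in component_in] component_sum flip: ad_addl)
  then show ?thesis
    using assms by (simp add: triangle_def parity_sum_def component_ad M_components flip: ad_add_apply)
qed

lemma homomorphism: "superalgebra_hom space M (bilinear_space S) (triangle S (neg S \<epsilon>)) ad"
  unfolding superalgebra_hom_def
proof (intro conjI allI ballI)
  show "linear_on space (bilinear_space S) ad" by (rule ad_linear)
  show "ad ` part space p \<subseteq> part (bilinear_space S) p" for p
    using ad_part by auto
  fix a b
  have E: "ad (M a b) \<in> carr S \<rightarrow>\<^sub>E (carr S \<rightarrow>\<^sub>E carr S)"
    using ad_in by (auto simp: bilinear_ops_def)
  show "ad (M a b) = triangle S (neg S \<epsilon>) (ad a) (ad b)"
  proof (intro ext)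
    fix x y
    show "ad (M a b) x y = triangle S (neg S \<epsilon>) (ad a) (ad b) x y"
    proof (cases "x \<in> carr S \<and> y \<in> carr S")
      case True
      then show ?thesis using triangle_ad by simp
    next
      case False
      then show ?thesis
        using PiE_arb[OF E] PiE_arb[OF PiE_mem[OF E]] by (auto simp: triangle_def)
    qed
  qed
qed

section \<open>The kernel of \<open>ad\<close>\<close>

lemma hom_kernel_iff: "a \<in> hom_kernel space (bilinear_space S) ad \<longleftrightarrow> (\<forall>x\<in>carr S. \<forall>y\<in>carr S. ad a x y = zer S)"
proof
  assume "a \<in> hom_kernel space (bilinear_space S) ad"
  then show "\<forall>x\<in>carr S. \<forall>y\<in>carr S. ad a x y = zer S"
    by (simp add: hom_kernel_def bilinear_space_simps)
next
  assume *: "\<forall>x\<in>carr S. \<forall>y\<in>carr S. ad a x y = zer S"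
  have E: "ad a \<in> carr S \<rightarrow>\<^sub>E (carr S \<rightarrow>\<^sub>E carr S)"
    using ad_in by (auto simp: bilinear_ops_def)
  have "ad a x y = zer (bilinear_space S) x y" for x y
    using * PiE_arb[OF E] PiE_arb[OF PiE_mem[OF E]]
    by (cases "x \<in> carr S \<and> y \<in> carr S") (auto simp: bilinear_space_def)
  then show "a \<in> hom_kernel space (bilinear_space S) ad"
    by (auto simp: hom_kernel_def)
qed

lemma ad_zero_if_homogeneous_zero:
  assumes "\<And>p j k x y. x \<in> part S j \<Longrightarrow> y \<in> part S k \<Longrightarrow> ad (comp p a) x y = zer S"
  shows "a \<in> hom_kernel space (bilinear_space S) ad"
proof -
  have "ad (comp p a) x y = zer S" if x: "x \<in> carr S" and y: "y \<in> carr S" for p x y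
  proof -
    have "ad (comp p a) (component S j x) y = zer S" for j
      using ad_addr[of "component S j x" "component S 0 y" "component S 1 y" "comp p a"] x y
      by (simp add: assms[OF component_in component_in] component_sum)
    then show ?thesis
      using ad_addl[of "component S 0 x" "component S 1 x" y "comp p a"] x y
      by (simp add: component_sum)
  qed
  then show ?thesis
    unfolding hom_kernel_iff
    using ad_add_apply[of _ _ "comp 0 a" "comp 1 a"] by (simp add: comp_sum)
qed

text \<open>This makes the kernel graded: the values at the two components of a lie in different
  parts of S and add up to zero, so uniqueness of the decomposition forces each to be zero.\<close>

lemma ad_component_zero:
  assumes a: "a \<in> hom_kernel space (bilinear_space S) ad" and x: "x \<in> part S j" and y: "y \<in> part S k"
  shows "ad (comp p a) x y = zer S"
proof -
  have c: "x \<in> carr S" "y \<in> carr S" using x y part_carr by auto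
  have "add S (ad (comp p a) x y) (ad (comp (p + 1) a) x y) = zer S"
    using a c by (simp add: comp_sum' hom_kernel_iff flip: ad_add_apply)
  moreover have "ad (comp p a) x y \<in> part S (p + j + k)"
    using ad_part_apply[OF comp_in x y] .
  moreover have "ad (comp (p + 1) a) x y \<in> part S (p + j + k + 1)"
    using ad_part_apply[OF comp_in x y, of "p + 1" a] by (simp add: ac_simps)
  ultimately show ?thesis
    using component_unique component_unique[of "zer S" "p + j + k" "zer S"] by (metis add_zer zer_closed part_zer)
qed

lemma kernel_jacobi_ideal: "jacobi_ideal M (hom_kernel space (bilinear_space S) ad)"
  unfolding jacobi_ideal_def two_sided_ideal_def graded_subspace_def
proof (intro conjI allI ballI)
  let ?K = "hom_kernel space (bilinear_space S) ad"
  have ad_0: "ad 0 x y = zer S" if "x \<in> carr S" "y \<in> carr S" for x y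
    using ad_scale_apply[of x y 0 0] that by simp
  then show "subspace ?K"
    by (auto simp: subspace_def hom_kernel_iff ad_add_apply ad_scale_apply)
  have comp_K: "comp p a \<in> ?K" if "a \<in> ?K" for a p
    using ad_component_zero[OF that]
    by (intro ad_zero_if_homogeneous_zero) (auto simp: comp_homogeneous[OF comp_in] ad_0 part_carr)
  then show "\<And>a p. a \<in> ?K \<Longrightarrow> comp p a \<in> ?K" .
  note closed = part_carr[OF part_neg[OF eps_part]]
  fix x a assume a: "a \<in> ?K"
  have zero: "ad (comp p a) y z = zer S" if "y \<in> carr S" "z \<in> carr S" for p y z
    using comp_K[OF a] that by (simp add: hom_kernel_iff)
  have sub: "sub S (zer S) (zer S) = zer S" by (simp add: sub_def neg_def)
  \<comment> \<open>Read from right to left, \<open>triangle_ad\<close> turns both products into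
    \<open>triangle\<close> with one operand zero in every summand.\<close>
  show "M x a \<in> ?K" "M a x \<in> ?K"
    unfolding hom_kernel_iff using closed
    by (auto simp: triangle_ad[symmetric] triangle_def parity_sum_def bracket_def hbracket_def component_ad
      zero ad_zerl ad_zerr sub)
next
  show "hom_kernel space (bilinear_space S) ad \<subseteq> jacobi_space M"
  proof
    fix a assume a: "a \<in> hom_kernel space (bilinear_space S) ad"
    have "brk p 0 (M (comp p a)) M u v = 0" for p u v
    proof -
      \<comment> \<open>Evaluating at - \<epsilon> in both places gives the bracket of L_a with
        \<Phi>(- \<epsilon>) = M, whose vanishing is the Jacobi condition.\<close>
      have "brk p 0 (M (comp p a)) (\<Phi> (neg S \<epsilon>)) u v = 0"
        using ad_component_zero[OF a part_neg[OF eps_part] part_neg[OF eps_part], of p]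
        by (simp flip: Phi_ad_neg_eps[OF comp_in part_neg[OF eps_part]] add: Phi_zer)
      moreover have "\<Phi> (neg S \<epsilon>) = M"
        using part_carr[OF eps_part] by (intro ext) (simp add: Phi_neg Phi_eps)
      ultimately show ?thesis by simp
    qed
    then show "a \<in> jacobi_space M"
      by (simp add: jacobi_space_iff[OF bil_M])
  qed
qed

text \<open>By \<open>Phi_span\<close>, \<Phi> x is [L_w, M] - s M for some w. Hence \<Phi> x
  applied to c in I is the supercommutator of L_w and L_c, minus L_(w c), minus s L_c. All three
  kill every \<Phi> y, because c and w c lie in I and the image of \<Phi> is stable under
  L_w.\<close>

lemma jacobi_ideal_in_kernel:
  assumes I: "jacobi_ideal M I"
  shows "I \<subseteq> hom_kernel space (bilinear_space S) ad"
proof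
  fix a assume "a \<in> I"
  have comp_I: "comp p c \<in> I" and ideal_I: "M x c \<in> I" "M c x \<in> I" and jacobi_I: "c \<in> jacobi_space M"
    if "c \<in> I" for p c x
    using I that by (auto simp: jacobi_ideal_def two_sided_ideal_def graded_subspace_def)
  have brk_M: "brk p 0 (M c) M u v = 0" if "c \<in> I" "c \<in> G p" for c p u v
    using jacobi_I[OF that(1)] comp_homogeneous[OF that(2), of p]
    by (auto simp: jacobi_space_iff[OF bil_M] dest: spec[of _ p])
  have brk_Phi: "brk p k (M c) (\<Phi> y) u v = 0" if c: "c \<in> I" "c \<in> G p" and y: "y \<in> part S k" for c p y k u v
  proof -
    obtain w s where w: "w \<in> G k" and s: "k \<noteq> 0 \<longrightarrow> s = 0"
      and Phi: "\<Phi> y = (\<lambda>u v. brk k 0 (M w) M u v - s *s M u v)"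
      using Phi_span[OF y] by (metis (no_types, lifting) ext)
    have lc: "lin p (M c)" and lw: "lin k (M w)" using c w lin_left_mult by auto
    have cw: "M c w \<in> I" "M c w \<in> G (p + k)"
      using c ideal_I bil_G[OF bil_M c(2) w] by auto
    \<comment> \<open>L_c is a superderivation, so its supercommutator with L_w is left
      multiplication by the product of c and w, again an element of I.\<close>
    have comm: "(\<lambda>z. M c (M w z) - psign (p * k) *s M w (M c z)) = M (M c w)"
      using brk_M[OF c, of w] by (auto simp: brk_def sg_homogeneous[OF w] bil_simps[OF bil_M] algebra_simps)
    have "brk p 0 (M c) M = (\<lambda>u v. 0)" using brk_M[OF c] by (intro ext)
    then have "brk p k (M c) (brk k 0 (M w) M) u v = 0"
      using brk_brk[OF lc lw bil_M, of u v] brk_M[OF cw]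
      by (simp add: comm brk_0B[OF lw])
    \<comment> \<open>M is even, so \<open>brk_M\<close> speaks of the bracket with second parity 0;
      for odd k the coefficient s is zero.\<close>
    moreover have "s *s brk p k (M c) M u v = 0"
      using s brk_M[OF c] by (cases "k = 0") auto
    ultimately show ?thesis
      unfolding Phi by (simp add: brk_diffB[OF lc] brk_scaleB[OF lc])
  qed
  show "a \<in> hom_kernel space (bilinear_space S) ad"
  proof (rule ad_zero_if_homogeneous_zero)
    fix i j k x y assume x: "x \<in> part S j" and y: "y \<in> part S k"
    let ?c = "comp i a"
    have c: "?c \<in> I" "?c \<in> G i" using comp_I[OF \<open>a \<in> I\<close>] by auto
    show "ad ?c x y = zer S"
    proof (rule Phi_inj)
      show "ad ?c x y \<in> carr S" using x y by (simp add: part_carr)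
      fix u v
      obtain w s where w: "w \<in> G j" and s: "j \<noteq> 0 \<longrightarrow> s = 0"
        and Phi: "\<Phi> x = (\<lambda>u v. brk j 0 (M w) M u v - s *s M u v)"
        using Phi_span[OF x] by (metis (no_types, lifting) ext)
      have lc: "lin i (M ?c)" and lw: "lin j (M w)" using c w lin_left_mult by auto
      note Y = Phi_bil[OF y]
      have wc: "M w ?c \<in> I" "M w ?c \<in> G (i + j)"
        using c ideal_I bil_G[OF bil_M w c(2)] by (auto simp: add.commute)
      have *: "\<Phi> x ?c = (\<lambda>z. ((M w (M ?c z) - psign (j * i) *s M ?c (M w z)) - M (M w ?c) z) - s *s M ?c z)"
        unfolding Phi by (intro ext) (simp add: brk_def sg_homogeneous[OF c(2)] bil_simps[OF bil_M])
      \<comment> \<open>Its image under \<Phi> is [L_w, \<Phi> y]. This exhibits the inner bracket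
        in one half of the supercommutator as an element of the image of \<Phi>, so that
        \<open>brk_Phi\<close> applies to it.\<close>
      have wy: "ad w (neg S \<epsilon>) y \<in> part S (j + k)" by (rule ad_neg_eps_part[OF w y])
      have "brk i k (M ?c) (\<Phi> y) = (\<lambda>u v. 0)" using brk_Phi[OF c y] by (intro ext)
      then have 1: "brk (j + i) k (\<lambda>z. M w (M ?c z) - psign (j * i) *s M ?c (M w z)) (\<Phi> y) u v = 0"
        using brk_brk[OF lw lc Y, of u v] brk_Phi[OF c wy, of u v]
        by (simp add: brk_0B[OF lw] Phi_ad_neg_eps[OF w y])
      have 2: "brk (i + j) k (M (M w ?c)) (\<Phi> y) u v = 0"
        by (rule brk_Phi[OF wc y])
      have 3: "brk (i + j) k (\<lambda>z. s *s M ?c z) (\<Phi> y) u v = 0"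
        using s brk_Phi[OF c y, of u v] brk_addA[OF Y, of "i + j" "\<lambda>z. 0" s "M ?c"] brk_0A[OF Y]
        by (cases "j = 0") auto
      have "brk (i + j) k (\<Phi> x ?c) (\<Phi> y) u v = 0"
        unfolding * using 1 2 3 by (simp add: brk_diffA[OF Y] add.commute)
      then show "\<Phi> (ad ?c x y) u v = 0"
        by (simp add: Phi_ad[OF c(2) x y])
    qed
  qed
qed

lemma kernel_maximal: "maximal_jacobi_ideal M (hom_kernel space (bilinear_space S) ad)"
  using kernel_jacobi_ideal jacobi_ideal_in_kernel by (simp add: maximal_jacobi_ideal_def)

end

subsection \<open>Quotients and adjoined units\<close>

text \<open>Trilinearity of one formula f gives both the bilinearity of each \<open>ad a\<close> and
  the linearity in a. All three constructions of an adjoint mapping have the restricted form assumed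
  here.\<close>

lemma (in carrier_superspace) linear_on_bilinear_spaceI:
  fixes V :: "('f, 'u) sspace"
  assumes ad: "\<And>a. ad a = (\<lambda>x\<in>carr S. \<lambda>y\<in>carr S. f a x y)"
    and closed: "\<And>a x y. a \<in> carr V \<Longrightarrow> x \<in> carr S \<Longrightarrow> y \<in> carr S \<Longrightarrow> f a x y \<in> carr S"
    and V: "\<And>a b. a \<in> carr V \<Longrightarrow> b \<in> carr V \<Longrightarrow> add V a b \<in> carr V" "\<And>c a. a \<in> carr V \<Longrightarrow> scl V c a \<in> carr V"
    and add1: "\<And>a b x y. a \<in> carr V \<Longrightarrow> b \<in> carr V \<Longrightarrow> x \<in> carr S \<Longrightarrow> y \<in> carr S \<Longrightarrow>
      f (add V a b) x y = add S (f a x y) (f b x y)"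
    and add2: "\<And>a x x' y. a \<in> carr V \<Longrightarrow> x \<in> carr S \<Longrightarrow> x' \<in> carr S \<Longrightarrow> y \<in> carr S \<Longrightarrow>
      f a (add S x x') y = add S (f a x y) (f a x' y)"
    and add3: "\<And>a x y y'. a \<in> carr V \<Longrightarrow> x \<in> carr S \<Longrightarrow> y \<in> carr S \<Longrightarrow> y' \<in> carr S \<Longrightarrow>
      f a x (add S y y') = add S (f a x y) (f a x y')"
    and scl1: "\<And>c a x y. a \<in> carr V \<Longrightarrow> x \<in> carr S \<Longrightarrow> y \<in> carr S \<Longrightarrow> f (scl V c a) x y = scl S c (f a x y)"
    and scl2: "\<And>c a x y. a \<in> carr V \<Longrightarrow> x \<in> carr S \<Longrightarrow> y \<in> carr S \<Longrightarrow> f a (scl S c x) y = scl S c (f a x y)"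
    and scl3: "\<And>c a x y. a \<in> carr V \<Longrightarrow> x \<in> carr S \<Longrightarrow> y \<in> carr S \<Longrightarrow> f a x (scl S c y) = scl S c (f a x y)"
  shows "linear_on V (bilinear_space S) ad"
proof -
  have "ad a \<in> bilinear_ops S" if "a \<in> carr V" for a
    using that unfolding bilinear_ops_def linear_on_def ad
    by (auto simp: closed add2 add3 scl2 scl3)
  moreover have "ad (add V a b) = add (bilinear_space S) (ad a) (ad b)" if "a \<in> carr V" "b \<in> carr V" for a b
    using that unfolding ad bilinear_space_def by (auto simp: add1 fun_eq_iff restrict_def)
  moreover have "ad (scl V c a) = scl (bilinear_space S) c (ad a)" if "a \<in> carr V" for c a
    using that unfolding ad bilinear_space_def by (auto simp: scl1 fun_eq_iff restrict_def)
  ultimately show ?thesis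
    by (auto simp: linear_on_def bilinear_space_def)
qed

context superspace
begin

lemma coset_self: "subspace J \<Longrightarrow> x \<in> coset J x"
  unfolding coset_def using subspace_0 by force

lemma coset_eq_iff:
  assumes "subspace J"
  shows "coset J x = coset J y \<longleftrightarrow> x - y \<in> J"
proof
  assume "coset J x = coset J y"
  then have "x \<in> coset J y" using coset_self[OF assms] by blast
  then show "x - y \<in> J" by (auto simp: coset_def)
next
  assume *: "x - y \<in> J"
  have "x + j = y + ((x - y) + j)" "y + j = x + (j - (x - y))" for j by simp_all
  then show "coset J x = coset J y"
    unfolding coset_def using * subspace_add[OF assms] subspace_diff[OF assms] by blast
qed

lemma coset_nonempty: "subspace J \<Longrightarrow> coset J x \<noteq> {}"
  using coset_self by blast

lemma mem_coset: "x \<in> coset J y \<longleftrightarrow> x - y \<in> J"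
  unfolding coset_def by (auto intro!: exI[of _ "x - y"])

lemma UN_coset:
  assumes J: "subspace J" and f: "\<And>x'. x' - x \<in> J \<Longrightarrow> f x' - f x \<in> J"
  shows "(\<Union>x'\<in>coset J x. coset J (f x')) = coset J (f x)"
  using coset_nonempty[OF J] f by (intro SUP_eq_const) (auto simp: coset_eq_iff[OF J] mem_coset)

lemma UN_coset2:
  assumes J: "subspace J"
    and f: "\<And>x' y'. x' - x \<in> J \<Longrightarrow> y' - y \<in> J \<Longrightarrow> f x' y' - f x y \<in> J"
  shows "(\<Union>x'\<in>coset J x. \<Union>y'\<in>coset J y. coset J (f x' y')) = coset J (f x y)"
proof (rule SUP_eq_const)
  show "coset J x \<noteq> {}" by (rule coset_nonempty[OF J])
  fix x' assume x': "x' \<in> coset J x"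
  show "(\<Union>y'\<in>coset J y. coset J (f x' y')) = coset J (f x y)"
    using coset_nonempty[OF J] f x'
    by (intro SUP_eq_const) (auto simp: coset_eq_iff[OF J] mem_coset)
qed

lemma quotient_simps:
  assumes J: "subspace J"
  shows "carr (quotient J) = range (coset J)"
    "add (quotient J) (coset J x) (coset J y) = coset J (x + y)"
    "zer (quotient J) = coset J 0"
    "scl (quotient J) c (coset J x) = coset J (c *s x)"
    "neg (quotient J) (coset J x) = coset J (- x)"
    "part (quotient J) p = coset J ` G p"
proof -
  have "(x' + y') - (x + y) \<in> J" if "x' - x \<in> J" "y' - y \<in> J" for x' y'
    using subspace_add[OF J that] by (simp add: algebra_simps)
  then show "add (quotient J) (coset J x) (coset J y) = coset J (x + y)"
    unfolding quotient_def using UN_coset2[OF J, of x y "(+)"] by simp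
  have *: "scl (quotient J) c (coset J x) = coset J (c *s x)" for c
    unfolding quotient_def
    by simp (rule UN_coset[OF J], metis subspace_scale[OF J] scale_right_diff_distrib)
  then show "scl (quotient J) c (coset J x) = coset J (c *s x)"
    "neg (quotient J) (coset J x) = coset J (- x)"
    by (simp_all add: neg_def)
qed (simp_all add: quotient_def)

lemma is_superspace_quotient:
  assumes "graded_subspace J"
  shows "is_superspace (quotient J)"
proof -
  have J: "subspace J" and J_comp: "\<And>x p. x \<in> J \<Longrightarrow> comp p x \<in> J"
    using assms by (auto simp: graded_subspace_def)
  note q = quotient_simps[OF J]
  have part: "subspace_of (quotient J) (part (quotient J) p)" for p
    unfolding subspace_of_def
    by (auto simp: q intro!: imageI G_intros)
  have carr: "subspace_of (quotient J) (carr (quotient J))"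
    unfolding subspace_of_def by (auto simp: q)
  have "\<exists>!y. y \<in> part (quotient J) 0 \<and> (\<exists>z\<in>part (quotient J) 1. coset J x = add (quotient J) y z)" for x
  proof (rule ex1I[of _ "coset J (comp 0 x)"])
    show "coset J (comp 0 x) \<in> part (quotient J) 0 \<and>
        (\<exists>z\<in>part (quotient J) 1. coset J x = add (quotient J) (coset J (comp 0 x)) z)"
      by (auto simp: q comp_sum intro!: imageI bexI[of _ "comp 1 x"])
    fix Y assume "Y \<in> part (quotient J) 0 \<and> (\<exists>z\<in>part (quotient J) 1. coset J x = add (quotient J) Y z)"
    then obtain y z where yz: "y \<in> G 0" "z \<in> G 1" "Y = coset J y" "coset J x = coset J (y + z)"
      by (auto simp: q)
    then have "x - (y + z) \<in> J" by (simp add: coset_eq_iff[OF J])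
    \<comment> \<open>Gradedness of J enters here: it makes the even part of a coset independent of
      the chosen representatives.\<close>
    then have "comp 0 (x - (y + z)) \<in> J" by (rule J_comp)
    then have "comp 0 x - y \<in> J"
      using yz by (simp add: comp_diff comp_add comp_homogeneous)
    then show "Y = coset J (comp 0 x)"
      using yz(3) coset_eq_iff[OF J] by metis
  qed
  then show ?thesis
    unfolding is_superspace_def using part carr
    by (auto simp: q algebra_simps)
qed

end

lemma is_superspace_adjoin_even:
  assumes "is_superspace S"
  shows "is_superspace (adjoin_even S)"
proof -
  interpret carrier_superspace S by (unfold_locales) (rule assms)
  have neg: "neg (adjoin_even S) (x, s) = (neg S x, - s)" for x s
    by (simp add: neg_def adjoin_even_def)
  have part: "subspace_of (adjoin_even S) (part (adjoin_even S) p)" for p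
    unfolding subspace_of_def
    by (auto simp: adjoin_even_def part_add part_scl part_carr split: if_splits)
  have carr: "subspace_of (adjoin_even S) (carr (adjoin_even S))"
    unfolding subspace_of_def by (auto simp: adjoin_even_def)
  have "\<exists>!y. y \<in> part (adjoin_even S) 0 \<and> (\<exists>z\<in>part (adjoin_even S) 1. (x, s) = add (adjoin_even S) y z)"
    if x: "x \<in> carr S" for x s
  proof (rule ex1I[of _ "(component S 0 x, s)"])
    show "(component S 0 x, s) \<in> part (adjoin_even S) 0 \<and>
        (\<exists>z\<in>part (adjoin_even S) 1. (x, s) = add (adjoin_even S) (component S 0 x, s) z)"
      using component_in[OF x]
      by (auto simp: adjoin_even_def component_sum[OF x] intro!: bexI[of _ "component S 1 x"])
    fix Y assume "Y \<in> part (adjoin_even S) 0 \<and> (\<exists>z\<in>part (adjoin_even S) 1. (x, s) = add (adjoin_even S) Y z)"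
    then obtain y z where "y \<in> part S 0" "z \<in> part S 1" "Y = (y, s)" "x = add S y z"
      by (auto simp: adjoin_even_def)
    then show "Y = (component S 0 x, s)"
      using component_unique[of y 0 z] by simp
  qed
  then show ?thesis
    unfolding is_superspace_def using part carr
    by (auto simp: adjoin_even_def neg[unfolded adjoin_even_def] add_assoc add_neg scl_add add_scl scl_scl
        algebra_simps intro: add_commute)
qed

subsection \<open>The adjoint mapping of a conservative superalgebra\<close>

context superspace
begin

lemma bilinear_space_space: "B \<in> part (bilinear_space space) p \<longleftrightarrow> bil p B"
  by (auto simp: bilinear_space_def bilinear_ops_def linear_on_def bil_def PiE_UNIV_domain)

end

locale conservative_superalgebra = superspace scale G
  for scale :: "'f::field \<Rightarrow> 'v::ab_group_add \<Rightarrow> 'v" (infixr "*s" 75)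
    and G :: "bit \<Rightarrow> 'v set" +
  fixes M star :: "'v \<Rightarrow> 'v \<Rightarrow> 'v"
  assumes bil_M: "bil 0 M"
    and associated: "associated_mult M star"
begin

abbreviation J :: "'v set" where "J \<equiv> jacobi_space M"

section \<open>The operations attached to elements of V, and the action of left multiplications on
  them\<close>

lemma bil_star: "bil 0 star"
  using associated by (simp add: associated_mult_def bilinear_space_space)

lemma lin_left_mult: "a \<in> G i \<Longrightarrow> lin i (M a)"
  using lin_bil[OF bil_M, of a i] by simp

text \<open>This is [L_x, M] extended linearly in x. The components are separated because
  \<open>brk\<close> takes the parity of the operator as a parameter.\<close>

definition psi :: "'v \<Rightarrow> 'v \<Rightarrow> 'v \<Rightarrow> 'v" where
  "psi x u v = brk 0 0 (M (comp 0 x)) M u v + brk 1 0 (M (comp 1 x)) M u v"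

lemma psi_add: "psi (x + y) u v = psi x u v + psi y u v"
  and psi_scale: "psi (c *s x) u v = c *s psi x u v"
  by (simp_all add: psi_def brk_def comp_add comp_scale bil_simps[OF bil_M] algebra_simps)

lemma psi_neg: "psi (- x) u v = - psi x u v"
  using psi_scale[of "- 1" x] by simp

lemma psi_diff: "psi (x - y) u v = psi x u v - psi y u v"
  using psi_add[of x "- y"] by (simp add: psi_neg)

lemma psi_0: "psi 0 u v = 0"
  using psi_scale[of 0 0] by simp

lemmas psi_simps = psi_add psi_scale psi_neg psi_diff psi_0

lemma psi_homogeneous: "x \<in> G p \<Longrightarrow> psi x = brk p 0 (M x) M"
  by (intro ext, cases p) (simp_all add: psi_def comp_homogeneous brk_def bil_simps[OF bil_M])

lemma bil_psi: "x \<in> G p \<Longrightarrow> bil p (psi x)"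
  using bil_brk[OF lin_left_mult bil_M] by (simp add: psi_homogeneous)

text \<open>The two summands of \<open>psi x\<close> have different parities, so if their sum
  vanishes, each is the negative of the other, has both parities and is zero by
  \<open>bil_eq_zero\<close>.\<close>

lemma psi_eq_zero_iff: "(\<forall>u v. psi x u v = 0) \<longleftrightarrow> x \<in> J"
proof
  assume "x \<in> J"
  then show "\<forall>u v. psi x u v = 0"
    by (simp add: jacobi_space_iff[OF bil_M] psi_def)
next
  assume psi: "\<forall>u v. psi x u v = 0"
  let ?A = "brk 0 0 (M (comp 0 x)) M" and ?B = "brk 1 0 (M (comp 1 x)) M"
  have bil: "bil 0 ?A" "bil 1 ?B"
    using bil_brk[OF lin_left_mult[OF comp_in] bil_M] by fastforce+
  have "?A = (\<lambda>u v. (- 1) *s ?B u v)"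
    using psi by (intro ext) (simp add: psi_def eq_neg_iff_add_eq_0)
  then have "bil 1 ?A"
    using bil(2) by (simp add: bil_def G_neg)
  then have A: "?A u v = 0" for u v
    using bil_eq_zero[OF bil(1)] by simp
  then have "brk p 0 (M (comp p x)) M u v = 0" for p u v
    using psi by (cases p) (simp_all add: psi_def)
  then show "x \<in> J"
    by (simp add: jacobi_space_iff[OF bil_M])
qed

lemma graded_J: "graded_subspace J"
proof -
  have "comp p x \<in> J" if "x \<in> J" for p x
    using that unfolding jacobi_space_iff[OF bil_M]
    by (auto simp: comp_homogeneous[OF comp_in] brk_def bil_simps[OF bil_M])
  then show ?thesis
    unfolding graded_subspace_def subspace_def
    by (auto simp: psi_simps simp flip: psi_eq_zero_iff)
qed

lemma subspace_J: "subspace J"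
  using graded_J by (simp add: graded_subspace_def)

lemma comp_J: "x \<in> J \<Longrightarrow> comp p x \<in> J"
  using graded_J by (simp add: graded_subspace_def)

lemma psi_eq_iff: "psi x = psi y \<longleftrightarrow> x - y \<in> J"
  by (auto simp: psi_diff fun_eq_iff simp flip: psi_eq_zero_iff)

text \<open>Conservativity with L_x as the inner and L_a as the outer operator, which explains the
  order of factors in \<open>star x a\<close>.\<close>

lemma brk_psi:
  assumes a: "a \<in> G i" and x: "x \<in> G j"
  shows "brk i j (M a) (psi x) u v = - (psign (i * j) *s psi (star x a) u v)"
proof -
  have xa: "star x a \<in> G (j + i)" using bil_G[OF bil_star x a] by simp
  have "bracket space i j (M a) (bracket space j 0 (M x) M) u v =
      - (psign (j * i) *s bracket space (j + i) 0 (M (star x a)) M u v)"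
    using associated a x by (simp add: associated_mult_def)
  moreover have "bracket space j 0 (M x) M = psi x"
    using bracket_eq_brk[OF lin_left_mult[OF x] bil_M] psi_homogeneous[OF x] by simp
  moreover have "bracket space (j + i) 0 (M (star x a)) M = psi (star x a)"
    using bracket_eq_brk[OF lin_left_mult[OF xa] bil_M] psi_homogeneous[OF xa] by simp
  ultimately show ?thesis
    using bracket_eq_brk[OF lin_left_mult[OF a] bil_psi[OF x]] by (simp add: mult.commute)
qed

text \<open>\<open>rho x s\<close> is the operation attached to \<open>x + s \<epsilon>\<close>.\<close>

definition rho :: "'v \<Rightarrow> 'f \<Rightarrow> 'v \<Rightarrow> 'v \<Rightarrow> 'v" where
  "rho x s u v = psi x u v - s *s M u v"

lemma bil_rho: "x \<in> G p \<Longrightarrow> p \<noteq> 0 \<longrightarrow> s = 0 \<Longrightarrow> bil p (rho x s)"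
  using bil_psi[of x p] bil_M
  by (cases "p = 0") (auto simp: bil_def rho_def algebra_simps intro!: G_intros)

text \<open>The action of \<open>L\<^sub>a\<close> on \<open>y + t \<epsilon>\<close>.\<close>

definition act :: "bit \<Rightarrow> bit \<Rightarrow> 'v \<Rightarrow> 'v \<Rightarrow> 'f \<Rightarrow> 'v" where
  "act i k a y t = - (psign (i * k) *s star y a) - t *s a"

lemma act_in: "a \<in> G i \<Longrightarrow> y \<in> G k \<Longrightarrow> k \<noteq> 0 \<longrightarrow> t = 0 \<Longrightarrow> act i k a y t \<in> G (i + k)"
  using bil_G[OF bil_star, of y k a i]
  by (cases "k = 0") (auto simp: act_def add.commute intro!: G_intros)

lemma brk_rho:
  assumes a: "a \<in> G i" and y: "y \<in> G k" and t: "k \<noteq> 0 \<longrightarrow> t = 0"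
  shows "brk i k (M a) (rho y t) u v = psi (act i k a y t) u v"
proof -
  have "brk i k (M a) (rho y t) u v = brk i k (M a) (psi y) u v - t *s brk i k (M a) M u v"
    unfolding rho_def[abs_def] by (simp add: brk_diffB[OF lin_left_mult[OF a]] brk_scaleB[OF lin_left_mult[OF a]])
  also have "t *s brk i k (M a) M u v = t *s psi a u v"
    using t by (cases "k = 0") (auto simp: psi_homogeneous[OF a])
  finally show ?thesis
    by (simp add: brk_psi[OF a y] act_def psi_simps)
qed

text \<open>The operator \<open>rho x s a\<close> is the supercommutator of L_x and L_a, minus L_(x
  a), minus s L_a. Each of these acts on the image of \<open>rho\<close> through \<open>act\<close>,
  so the bracket is \<open>psi\<close> of an explicit element. This element, up to sign, is the
  source of the formulas for \<open>ad\<close>.\<close>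

lemma psi_brk:
  assumes a: "a \<in> G i" and x: "x \<in> G j" and s: "j \<noteq> 0 \<longrightarrow> s = 0" and y: "y \<in> G k" and t: "k \<noteq> 0 \<longrightarrow> t = 0"
  shows "brk (i + j) k (rho x s a) (rho y t) u v =
    psi (act j (i + k) x (act i k a y t) 0 - psign (i * j) *s act i (j + k) a (act j k x y t) 0
      - act (i + j) k (M x a) y t - s *s act i k a y t) u v"
proof -
  note La = lin_left_mult[OF a] and Lx = lin_left_mult[OF x] and Y = bil_rho[OF y t]
  have xa: "M x a \<in> G (i + j)" using bil_G[OF bil_M x a] by (simp add: add.commute)
  have *: "rho x s a = (\<lambda>z. ((M x (M a z) - psign (j * i) *s M a (M x z)) - M (M x a) z) - s *s M a z)"
    by (intro ext) (simp add: rho_def psi_homogeneous[OF x] brk_def sg_homogeneous[OF a] bil_simps[OF bil_M] mult.commute)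
  have rho_0: "rho w 0 = psi w" for w by (simp add: rho_def fun_eq_iff)
  \<comment> \<open>An action always lands in V, so the coefficient of \<epsilon> becomes 0 after
    the first operator.\<close>
  have fa: "brk i k (M a) (rho y t) = rho (act i k a y t) 0"
    and fx: "brk j k (M x) (rho y t) = rho (act j k x y t) 0"
    unfolding rho_0 by (intro ext, rule brk_rho, fact+)+
  have 1: "brk (i + j) k (\<lambda>z. M x (M a z) - psign (j * i) *s M a (M x z)) (rho y t) u v =
      psi (act j (i + k) x (act i k a y t) 0) u v - psign (i * j) *s psi (act i (j + k) a (act j k x y t) 0) u v"
    using brk_brk[OF Lx La Y, of u v] brk_rho[OF x act_in[OF a y t], of 0 u v] brk_rho[OF a act_in[OF x y t], of 0 u v]
    by (simp add: fa fx add.commute mult.commute)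
  have 2: "brk (i + j) k (M (M x a)) (rho y t) u v = psi (act (i + j) k (M x a) y t) u v"
    by (rule brk_rho[OF xa y t])
  have 3: "brk (i + j) k (\<lambda>z. s *s M a z) (rho y t) u v = s *s psi (act i k a y t) u v"
    using s brk_addA[OF Y, of "i + j" "\<lambda>z. 0" s "M a" u v] brk_0A[OF Y]
    by (cases "j = 0") (auto simp: brk_rho[OF a y t])
  have "brk (i + j) k (rho x s a) (rho y t) u v =
      brk (i + j) k (\<lambda>z. M x (M a z) - psign (j * i) *s M a (M x z)) (rho y t) u v
      - brk (i + j) k (M (M x a)) (rho y t) u v - brk (i + j) k (\<lambda>z. s *s M a z) (rho y t) u v"
    unfolding * by (simp add: brk_diffA[OF Y])
  then show ?thesis
    unfolding 1 2 3 by (simp add: psi_simps)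
qed

section \<open>The formulas defining \<open>ad\<close>, on representatives\<close>

definition main_term :: "bit \<Rightarrow> bit \<Rightarrow> bit \<Rightarrow> 'v \<Rightarrow> 'v \<Rightarrow> 'v \<Rightarrow> 'v" where
  "main_term i j k a x y = psign (k * (i + j)) *s
    (star (star y a) x + psign (j * i) *s star y (M x a) - psign (j * i) *s star (star y x) a)"

lemma ad_main_eq: "ad_main M star a x y =
    (\<Sum>i\<in>{0, 1}. \<Sum>j\<in>{0, 1}. \<Sum>k\<in>{0, 1}. main_term i j k (comp i a) (comp j x) (comp k y))"
  by (simp only: ad_main_def main_term_def Let_def)

lemma main_term_simps:
  "main_term i j k (a + a') x y = main_term i j k a x y + main_term i j k a' x y"
  "main_term i j k a (x + x') y = main_term i j k a x y + main_term i j k a x' y"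
  "main_term i j k a x (y + y') = main_term i j k a x y + main_term i j k a x y'"
  "main_term i j k (c *s a) x y = c *s main_term i j k a x y"
  "main_term i j k a (c *s x) y = c *s main_term i j k a x y"
  "main_term i j k a x (c *s y) = c *s main_term i j k a x y"
  "main_term i j k 0 x y = 0" "main_term i j k a 0 y = 0" "main_term i j k a x 0 = 0"
  by (simp_all add: main_term_def bil_simps[OF bil_M] bil_simps[OF bil_star] algebra_simps scale_left_commute)

text \<open>A single formula for both cases: s = t = 0 gives \<open>ad_quasiunital\<close>, and
  arbitrary coefficients of \<epsilon> give \<open>ad_extended\<close>.\<close>

definition ext_ad :: "'v \<Rightarrow> 'v \<Rightarrow> 'f \<Rightarrow> 'v \<Rightarrow> 'f \<Rightarrow> 'v" where
  "ext_ad a x s y t = ad_main M star a x y + t *s ad_right M star a x + s *s ad_left star a y + (s * t) *s a"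

lemma ext_ad_add:
  "ext_ad (a + a') x s y t = ext_ad a x s y t + ext_ad a' x s y t"
  "ext_ad a (x + x') (s + s') y t = ext_ad a x s y t + ext_ad a x' s' y t"
  "ext_ad a x s (y + y') (t + t') = ext_ad a x s y t + ext_ad a x s y' t'"
  by (simp_all add: ext_ad_def ad_main_eq main_term_simps ad_right_def ad_left_def Let_def comp_add
    bil_simps[OF bil_M] bil_simps[OF bil_star] sum.distrib algebra_simps scale_left_commute)

lemma ext_ad_scale:
  "ext_ad (c *s a) x s y t = c *s ext_ad a x s y t"
  "ext_ad a (c *s x) (c * s) y t = c *s ext_ad a x s y t"
  "ext_ad a x s (c *s y) (c * t) = c *s ext_ad a x s y t"
  by (simp_all add: ext_ad_def ad_main_eq main_term_simps ad_right_def ad_left_def Let_def comp_scale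
    bil_simps[OF bil_M] bil_simps[OF bil_star] scale_right_distrib scale_right_diff_distrib
    scale_left_commute mult.left_commute mult.commute)

text \<open>Up to signs, the four summands on the right unfold to \<open>star (star y a) x\<close>
  and \<open>t *s star a x\<close>; to \<open>star (star y x) a\<close> and
  \<open>t *s star x a\<close>; to \<open>star y (M x a)\<close> and \<open>t *s M x a\<close>; to
  \<open>s *s star y a\<close> and \<open>(s * t) *s a\<close>. These are exactly the terms of
  \<open>ad_main\<close>, \<open>ad_right\<close>, \<open>ad_left\<close> and the value at
  (\<epsilon>, \<epsilon>).\<close>

lemma ext_ad_homogeneous:
  assumes a: "a \<in> G i" and x: "x \<in> G j" and s: "j \<noteq> 0 \<longrightarrow> s = 0" and y: "y \<in> G k" and t: "k \<noteq> 0 \<longrightarrow> t = 0"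
  shows "ext_ad a x s y t = psign (i * j) *s
    (act j (i + k) x (act i k a y t) 0 - psign (i * j) *s act i (j + k) a (act j k x y t) 0
      - act (i + j) k (M x a) y t - s *s act i k a y t)"
  using s t
  by (cases i; cases j; cases k)
    (simp_all add: ext_ad_def ad_main_eq main_term_def ad_right_def ad_left_def Let_def act_def
      comp_homogeneous[OF a] comp_homogeneous[OF x] comp_homogeneous[OF y]
      bil_simps[OF bil_M] bil_simps[OF bil_star] algebra_simps scale_left_commute)

lemma psi_ext_ad:
  assumes "a \<in> G i" "x \<in> G j" "j \<noteq> 0 \<longrightarrow> s = 0" "y \<in> G k" "k \<noteq> 0 \<longrightarrow> t = 0"
  shows "psi (ext_ad a x s y t) u v = psign (i * j) *s brk (i + j) k (rho x s a) (rho y t) u v"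
  unfolding psi_brk[OF assms] ext_ad_homogeneous[OF assms] by (simp add: psi_simps)

text \<open>As \<epsilon> is even, its coefficient accompanies the even component, whence the
  conditionals.\<close>

lemma ext_ad_components: "ext_ad a x s y t =
    (\<Sum>i\<in>{0, 1}. \<Sum>j\<in>{0, 1}. \<Sum>k\<in>{0, 1}. ext_ad (comp i a)
      (comp j x) (if j = 0 then s else 0) (comp k y) (if k = 0 then t else 0))"
proof -
  have 3: "ext_ad a x s y t = ext_ad a x s (comp 0 y) t + ext_ad a x s (comp 1 y) 0" for a x s
    using ext_ad_add(3)[of a x s "comp 0 y" "comp 1 y" t 0] by (simp add: comp_sum)
  have 2: "ext_ad a x s y t = ext_ad a (comp 0 x) s y t + ext_ad a (comp 1 x) 0 y t" for a
    using ext_ad_add(2)[of a "comp 0 x" "comp 1 x" s 0 y t] by (simp add: comp_sum)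
  have 1: "ext_ad a x s y t = ext_ad (comp 0 a) x s y t + ext_ad (comp 1 a) x s y t"
    using ext_ad_add(1)[of "comp 0 a" "comp 1 a" x s y t] by (simp add: comp_sum)
  have i: "ext_ad a x s y t = (\<Sum>i\<in>{0, 1}. ext_ad (comp i a) x s y t)"
    by (simp add: 1)
  have j: "ext_ad b x s y t = (\<Sum>j\<in>{0, 1}. ext_ad b (comp j x) (if j = 0 then s else 0) y t)" for b
    by (simp add: 2)
  have k: "ext_ad b z r y t = (\<Sum>k\<in>{0, 1}. ext_ad b z r (comp k y) (if k = 0 then t else 0))" for b z r
    by (simp add: 3)
  show ?thesis
    unfolding i unfolding j unfolding k ..
qed

text \<open>Well-definedness modulo J requires no manipulation of \<open>star\<close>: an operand in
  J has \<open>rho\<close> equal to zero, so the bracket computing \<open>psi\<close> of the value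
  vanishes, and J is the kernel of \<open>psi\<close>.\<close>

lemma ext_ad_J:
  assumes "x \<in> J \<and> s = 0 \<or> y \<in> J \<and> t = 0"
  shows "ext_ad a x s y t \<in> J"
proof -
  have "ext_ad (comp i a) (comp j x) (if j = 0 then s else 0) (comp k y) (if k = 0 then t else 0) \<in> J" for i j k
  proof -
    let ?s = "if j = 0 then s else 0" and ?t = "if k = 0 then t else 0"
    have z: "rho (comp i w) 0 = (\<lambda>u v. 0)" if "w \<in> J" for i w
      using comp_J[OF that, of i] by (intro ext) (simp add: rho_def psi_eq_zero_iff[symmetric])
    have x: "bil j (rho (comp j x) ?s)" and y: "bil k (rho (comp k y) ?t)"
      by (auto intro!: bil_rho)
    have "brk (i + j) k (rho (comp j x) ?s (comp i a)) (rho (comp k y) ?t) u v = 0" for u v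
      using assms
    proof
      assume "x \<in> J \<and> s = 0"
      then have "?s = 0" "x \<in> J" by simp_all
      then have "rho (comp j x) ?s = (\<lambda>u v. 0)" by (simp only: z)
      then show ?thesis by (simp only: brk_0A[OF y])
    next
      assume "y \<in> J \<and> t = 0"
      then have "?t = 0" "y \<in> J" by simp_all
      then have "rho (comp k y) ?t = (\<lambda>u v. 0)" by (simp only: z)
      then show ?thesis by (simp only: brk_0B[OF lin_bil[OF x comp_in]])
    qed
    then show ?thesis
      by (simp add: psi_ext_ad[OF comp_in comp_in _ comp_in] flip: psi_eq_zero_iff)
  qed
  then show ?thesis
    by (subst ext_ad_components) (intro subspace_sum[OF subspace_J])
qed

lemma ext_ad_cong_J:
  assumes "x' - x \<in> J" "y' - y \<in> J"
  shows "ext_ad a x' s y' t - ext_ad a x s y t \<in> J"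
proof -
  have "ext_ad a x' s y' t = ext_ad a x s y t + ext_ad a x s (y' - y) 0 + ext_ad a (x' - x) 0 y' t"
    using ext_ad_add(3)[of a x s y "y' - y" t 0] ext_ad_add(2)[of a x "x' - x" s 0 y' t] by simp
  moreover have "ext_ad a x s (y' - y) 0 + ext_ad a (x' - x) 0 y' t \<in> J"
    using assms by (intro subspace_add[OF subspace_J] ext_ad_J) auto
  ultimately show ?thesis by (simp add: algebra_simps)
qed

section \<open>The two instances, with and without a left quasiunity\<close>

lemma is_superspace_VJ: "is_superspace (quotient J)"
  by (rule is_superspace_quotient[OF graded_J])

lemmas VJ = quotient_simps[OF subspace_J]

definition Phi_VJ :: "'v set \<Rightarrow> 'v \<Rightarrow> 'v \<Rightarrow> 'v" where
  "Phi_VJ X = psi (SOME x. X = coset J x)"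

lemma Phi_VJ_coset [simp]: "Phi_VJ (coset J x) = psi x"
proof -
  have "coset J x = coset J (SOME y. coset J x = coset J y)" by (rule someI) (rule refl)
  then have "psi x = psi (SOME y. coset J x = coset J y)"
    unfolding psi_eq_iff coset_eq_iff[OF subspace_J] .
  then show ?thesis by (simp add: Phi_VJ_def)
qed

lemma ad_quasiunital_eq: "ad_quasiunital M star a =
    (\<lambda>X\<in>carr (quotient J). \<lambda>Y\<in>carr (quotient J). \<Union>x\<in>X. \<Union>y\<in>Y. coset J (ext_ad a x 0 y 0))"
  by (simp add: ad_quasiunital_def ext_ad_def Let_def)

lemma ad_extended_eq: "ad_extended M star a =
    (\<lambda>p\<in>carr (adjoin_even (quotient J)). \<lambda>q\<in>carr (adjoin_even (quotient J)).
      (\<Union>x\<in>fst p. \<Union>y\<in>fst q. coset J (ext_ad a x (snd p) y (snd q)), 0))"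
  by (simp add: ad_extended_def ext_ad_def Let_def fun_eq_iff restrict_def split_beta)

lemma UN_ext_ad: "(\<Union>x'\<in>coset J x. \<Union>y'\<in>coset J y. coset J (ext_ad a x' s y' t)) = coset J (ext_ad a x s y t)"
  by (rule UN_coset2[OF subspace_J ext_ad_cong_J])

lemma adjoint_rep_quasiunital:
  assumes e: "left_quasiunity M e"
  shows "adjoint_rep scale G (quotient J) M Phi_VJ (coset J e) (ad_quasiunital M star)"
proof -
  interpret S: carrier_superspace "quotient J"
    by unfold_locales (rule is_superspace_VJ)
  have rho_0: "rho x 0 = psi x" for x by (simp add: rho_def fun_eq_iff)
  show ?thesis
  proof unfold_locales
    show "linear_on space (bilinear_space (quotient J)) (ad_quasiunital M star)"
      by (rule S.linear_on_bilinear_spaceI[OF ad_quasiunital_eq])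
        ((clarsimp simp: VJ UN_ext_ad; simp add: ext_ad_add ext_ad_scale
          ext_ad_add(2)[where s = 0 and s' = 0, simplified] ext_ad_add(3)[where t = 0 and t' = 0, simplified]
          ext_ad_scale(2)[where s = 0, simplified] ext_ad_scale(3)[where t = 0, simplified])+)
    show "x = zer (quotient J)" if "x \<in> carr (quotient J)" "\<And>u v. Phi_VJ x u v = 0" for x
    proof -
      obtain y where y: "x = coset J y" using \<open>x \<in> carr (quotient J)\<close> by (auto simp: VJ)
      then have "y \<in> J" using that(2) by (simp flip: psi_eq_zero_iff)
      then show ?thesis by (simp add: y VJ coset_eq_iff[OF subspace_J])
    qed
    show "coset J e \<in> part (quotient J) 0"
      using e by (auto simp: VJ left_quasiunity_def)
    \<comment> \<open>Precisely the defining identity of a left quasiunity.\<close>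
    show "Phi_VJ (coset J e) u v = - M u v" for u v
      using e by (auto simp: left_quasiunity_def psi_homogeneous brk_def)
    show "\<exists>a\<in>G p. \<exists>s. (p \<noteq> 0 \<longrightarrow> s = 0) \<and> (\<forall>u v. Phi_VJ x u v = brk p 0 (M a) M u v - s *s M u v)"
      if "x \<in> part (quotient J) p" for x p
      using that by (auto simp: VJ psi_homogeneous intro!: bexI exI[of _ 0])
    show "Phi_VJ (ad_quasiunital M star a x y) u v = psign (i * j) *s brk (i + j) k (Phi_VJ x a) (Phi_VJ y) u v"
      if a: "a \<in> G i" and x: "x \<in> part (quotient J) j" and y: "y \<in> part (quotient J) k" for a x y i j k u v
    proof -
      obtain x' y' where x': "x = coset J x'" "x' \<in> G j" and y': "y = coset J y'" "y' \<in> G k"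
        using x y unfolding VJ(6) by blast
      then show ?thesis
        using psi_ext_ad[OF a x'(2) _ y'(2), of 0 0] by (simp add: VJ(1) ad_quasiunital_eq UN_ext_ad rho_0)
    qed
  qed (auto simp: bil_M VJ psi_add psi_scale bil_psi)
qed

definition Phi_ext :: "'v set \<times> 'f \<Rightarrow> 'v \<Rightarrow> 'v \<Rightarrow> 'v" where
  "Phi_ext p u v = Phi_VJ (fst p) u v - snd p *s M u v"

text \<open>Since M is even, the odd half of \<open>psi x\<close> is also even and therefore zero.
  What remains is [L_a, M] = M for the even component a of x, so - a is a left quasiunity. In the
  absence of left quasiunities this gives the injectivity of \<open>Phi_ext\<close>.\<close>

lemma left_quasiunity_if_psi_eq_M:
  assumes "psi x = M"
  shows "left_quasiunity M (- comp 0 x)"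
proof -
  let ?A = "brk 0 0 (M (comp 0 x)) M" and ?B = "brk 1 0 (M (comp 1 x)) M"
  have bil: "bil 0 ?A" "bil 1 ?B"
    using bil_brk[OF lin_left_mult[OF comp_in] bil_M] by fastforce+
  have "?B = (\<lambda>u v. M u v - ?A u v)"
    by (subst assms[symmetric]) (simp add: psi_def fun_eq_iff)
  then have "bil 0 ?B"
    using bil(1) bil_M by (simp add: bil_def algebra_simps G_diff)
  then have "?B u v = 0" for u v
    using bil_eq_zero[OF bil(2)] by simp
  then have "?A u v = M u v" for u v
    using fun_cong[OF fun_cong[OF assms], of u v] by (simp add: psi_def)
  then show ?thesis
    by (simp add: left_quasiunity_def brk_def bil_simps[OF bil_M] G_neg) (simp add: algebra_simps)
qed

lemma adjoint_rep_extended: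
  assumes no_unit: "\<nexists>e. left_quasiunity M e"
  shows "adjoint_rep scale G (adjoin_even (quotient J)) M Phi_ext (adjoined_unit (quotient J)) (ad_extended M star)"
proof -
  let ?W = "adjoin_even (quotient J)"
  have W: "is_superspace ?W" by (intro is_superspace_adjoin_even is_superspace_VJ)
  interpret S: carrier_superspace ?W
    by unfold_locales (rule W)
  have Phi: "Phi_ext (coset J x, s) = rho x s" for x s
    by (simp add: fun_eq_iff Phi_ext_def rho_def)
  note W_simps = adjoin_even_def VJ
  have part_W: "\<exists>y s. x = (coset J y, s) \<and> y \<in> G p \<and> (p \<noteq> 0 \<longrightarrow> s = 0)" if "x \<in> part ?W p" for x p
    using that by (cases p) (auto simp: W_simps)
  show ?thesis
  proof unfold_locales
    show "linear_on space (bilinear_space ?W) (ad_extended M star)"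
      by (rule S.linear_on_bilinear_spaceI[OF ad_extended_eq])
        ((clarsimp simp: W_simps UN_ext_ad; simp add: ext_ad_add ext_ad_scale)+)
    show "x = zer ?W" if "x \<in> carr ?W" "\<And>u v. Phi_ext x u v = 0" for x
    proof -
      obtain y s where x: "x = (coset J y, s)"
        using \<open>x \<in> carr ?W\<close> by (auto simp: W_simps)
      have psi: "psi y u v = s *s M u v" for u v
        using that(2) by (simp add: x Phi rho_def)
      have "s = 0"
      proof (rule ccontr)
        assume "s \<noteq> 0"
        \<comment> \<open>A nonzero coefficient of \<epsilon> could be divided out, which would
          produce a left quasiunity.\<close>
        then have "psi (inverse s *s y) = M"
          by (simp add: fun_eq_iff psi_scale psi)
        then show False using left_quasiunity_if_psi_eq_M no_unit by blast
      qed
      then have "y \<in> J" using psi by (simp flip: psi_eq_zero_iff)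
      with \<open>s = 0\<close> show ?thesis by (simp add: x W_simps coset_eq_iff[OF subspace_J])
    qed
    show "adjoined_unit (quotient J) \<in> part ?W 0"
      by (auto simp: W_simps adjoined_unit_def G_0)
    show "Phi_ext (adjoined_unit (quotient J)) u v = - M u v" for u v
      by (simp add: VJ adjoined_unit_def Phi rho_def psi_0)
    show "\<exists>a\<in>G p. \<exists>s. (p \<noteq> 0 \<longrightarrow> s = 0) \<and> (\<forall>u v. Phi_ext x u v = brk p 0 (M a) M u v - s *s M u v)"
      if x_in: "x \<in> part ?W p" for x p
    proof -
      obtain y s where x: "x = (coset J y, s)" and y: "y \<in> G p" and s: "p \<noteq> 0 \<longrightarrow> s = 0"
        using part_W[OF x_in] by blast
      have "\<forall>u v. Phi_ext x u v = brk p 0 (M y) M u v - s *s M u v"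
        by (simp add: x Phi rho_def psi_homogeneous[OF y])
      with y s show ?thesis by blast
    qed
    show "Phi_ext (ad_extended M star a x y) u v = psign (i * j) *s brk (i + j) k (Phi_ext x a) (Phi_ext y) u v"
      if a: "a \<in> G i" and x: "x \<in> part ?W j" and y: "y \<in> part ?W k" for a x y i j k u v
    proof -
      obtain x' s where x': "x = (coset J x', s)" "x' \<in> G j" "j \<noteq> 0 \<longrightarrow> s = 0"
        using part_W[OF x] by blast
      obtain y' t where y': "y = (coset J y', t)" "y' \<in> G k" "k \<noteq> 0 \<longrightarrow> t = 0"
        using part_W[OF y] by blast
      have "ad_extended M star a x y = (coset J (ext_ad a x' s y' t), 0)"
        by (simp add: ad_extended_eq x'(1) y'(1) UN_ext_ad W_simps)
      then show ?thesis
        using psi_ext_ad[OF a x'(2,3) y'(2,3)] by (simp add: x'(1) y'(1) Phi) (simp add: rho_def)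
    qed
    show "bil p (Phi_ext x)" if "x \<in> part ?W p" for x p
      using that by (auto simp: W_simps Phi intro: bil_rho split: if_splits)
  qed (auto simp: bil_M W_simps Phi rho_def psi_add psi_scale algebra_simps)
qed

end

subsection \<open>Transport along isomorphisms\<close>

definition graded_iso :: "('f::field, 'w) sspace \<Rightarrow> ('f, 'u) sspace \<Rightarrow> ('w \<Rightarrow> 'u) \<Rightarrow> bool" where
  "graded_iso S T f \<longleftrightarrow> linear_on S T f \<and> bij_betw f (carr S) (carr T) \<and> (\<forall>p. f ` part S p \<subseteq> part T p)"

lemma linear_onD:
  assumes "linear_on S T f"
  shows "x \<in> carr S \<Longrightarrow> f x \<in> carr T"
    and "x \<in> carr S \<Longrightarrow> y \<in> carr S \<Longrightarrow> f (add S x y) = add T (f x) (f y)"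
    and "x \<in> carr S \<Longrightarrow> f (scl S c x) = scl T c (f x)"
  using assms by (auto simp: linear_on_def)

text \<open>Pulling \<Phi> back along f and conjugating \<open>ad\<close> by f preserves every
  assumption of the locale. For an arbitrary model of U(k, m) it therefore suffices to find a graded
  isomorphism with the right value at one vector.\<close>

lemma (in adjoint_rep) transport:
  fixes T :: "('f, 'u) sspace"
  assumes T: "is_superspace T" and iso: "graded_iso T S f" and u: "u \<in> part T 0" "f u = \<epsilon>"
  shows "adjoint_rep scale G T M (\<Phi> \<circ> f) u
    (\<lambda>a. \<lambda>x\<in>carr T. \<lambda>y\<in>carr T. inv_into (carr T) f (ad a (f x) (f y)))"
proof -
  interpret T: carrier_superspace T by unfold_locales (rule T)
  define g where "g = inv_into (carr T) f"
  have lin: "linear_on T S f" and bij: "bij_betw f (carr T) (carr S)"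
    and part: "\<And>x p. x \<in> part T p \<Longrightarrow> f x \<in> part S p"
    using iso by (auto simp: graded_iso_def)
  note f = linear_onD[OF lin]
  have g_closed: "g y \<in> carr T" and fg: "f (g y) = y" if "y \<in> carr S" for y
    using bij that unfolding g_def
    by (simp_all add: bij_betw_def inv_into_into f_inv_into_f)
  have inj: "x = y" if "x \<in> carr T" "y \<in> carr T" "f x = f y" for x y
    using bij that by (auto simp: bij_betw_def dest: inj_onD)
  have g_add: "g (add S x y) = add T (g x) (g y)" if "x \<in> carr S" "y \<in> carr S" for x y
    using that by (intro inj) (simp_all add: f fg g_closed)
  have g_scl: "g (scl S c x) = scl T c (g x)" if "x \<in> carr S" for c x
    using that by (intro inj) (simp_all add: f fg g_closed)
  have f_zer: "f (zer T) = zer S"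
    using f(3)[of "zer T" 0] f(1)[of "zer T"] by simp
  show ?thesis
    unfolding g_def[symmetric]
  proof unfold_locales
    show "linear_on space (bilinear_space T) (\<lambda>a. \<lambda>x\<in>carr T. \<lambda>y\<in>carr T. g (ad a (f x) (f y)))"
      by (rule T.linear_on_bilinear_spaceI[OF refl])
        (simp_all add: f g_closed g_add g_scl ad_add_apply ad_scale_apply ad_addl ad_addr
          bilinear_ops_scll[OF ad_in] bilinear_ops_sclr[OF ad_in])
    show "x = zer T" if "x \<in> carr T" "\<And>u v. (\<Phi> \<circ> f) x u v = 0" for x
      using that by (intro inj) (simp_all add: f_zer Phi_inj f)
    show "\<exists>a\<in>G p. \<exists>s. (p \<noteq> 0 \<longrightarrow> s = 0) \<and> (\<forall>u v. (\<Phi> \<circ> f) x u v = brk p 0 (M a) M u v - s *s M u v)"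
      if "x \<in> part T p" for x p
      using Phi_span[OF part[OF that]] by simp
    show "(\<Phi> \<circ> f) ((\<lambda>x\<in>carr T. \<lambda>y\<in>carr T. g (ad a (f x) (f y))) x y) u v =
        psign (i * j) *s brk (i + j) k ((\<Phi> \<circ> f) x a) ((\<Phi> \<circ> f) y) u v"
      if "a \<in> G i" "x \<in> part T j" "y \<in> part T k" for a i x j y k u v
      using that T.part_carr[OF that(2)] T.part_carr[OF that(3)]
      by (simp add: fg f Phi_ad part)
  qed (simp_all add: bil_M Phi_add Phi_scl Phi_bil Phi_eps u f part)
qed

section \<open>Coordinates with respect to a basis and the resulting isomorphisms\<close>

lemma lincomb_simps [simp]:
  "lincomb S [] [] = zer S"
  "lincomb S (c # cs) (b # bs) = add S (scl S c b) (lincomb S cs bs)"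
  by (simp_all add: lincomb_def)

context carrier_superspace
begin

lemma lincomb_in:
  assumes U: "subspace_of S U"
  shows "length cs = length bs \<Longrightarrow> set bs \<subseteq> U \<Longrightarrow> lincomb S cs bs \<in> U"
  by (induction cs bs rule: list_induct2) (use U in \<open>auto simp: subspace_of_def\<close>)

lemma lincomb_add:
  "length cs = length bs \<Longrightarrow> length ds = length bs \<Longrightarrow> set bs \<subseteq> carr S \<Longrightarrow>
    lincomb S (map2 (+) cs ds) bs = add S (lincomb S cs bs) (lincomb S ds bs)"
proof (induction cs bs arbitrary: ds rule: list_induct2)
  case (Cons c cs b bs)
  then obtain d ds' where ds: "ds = d # ds'" "length ds' = length bs" by (cases ds) auto
  let ?x = "lincomb S cs bs" and ?y = "lincomb S ds' bs"
  have "subspace_of S (carr S)" by (simp add: subspace_of_def)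
  then have x: "?x \<in> carr S" and y: "?y \<in> carr S"
    using lincomb_in Cons.hyps Cons.prems ds by auto
  have b: "b \<in> carr S" using Cons.prems by simp
  have "add S (add S (scl S c b) (scl S d b)) (add S ?x ?y) =
      add S (add S (scl S c b) ?x) (add S (scl S d b) ?y)"
    using x y b by (simp add: add_swap[of "scl S c b"])
  with Cons ds b show ?case by (simp add: add_scl)
qed simp

lemma lincomb_scl:
  "length cs = length bs \<Longrightarrow> set bs \<subseteq> carr S \<Longrightarrow> lincomb S (map ((*) c) cs) bs = scl S c (lincomb S cs bs)"
proof (induction cs bs rule: list_induct2)
  case (Cons d cs b bs)
  have "subspace_of S (carr S)" by (simp add: subspace_of_def)
  then have "lincomb S cs bs \<in> carr S"
    using lincomb_in Cons.hyps Cons.prems by auto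
  with Cons show ?case by (simp add: scl_add scl_scl)
qed simp

end

text \<open>\<open>linear_on\<close> speaks of whole carriers, whereas the homogeneous components
  are only subsets of a carrier; hence a notion relative to subsets.\<close>

definition partial_iso :: "('f::field, 'w) sspace \<Rightarrow> 'w set \<Rightarrow> ('f, 'u) sspace \<Rightarrow> 'u set \<Rightarrow> ('w \<Rightarrow> 'u) \<Rightarrow> bool" where
  "partial_iso S U T U' f \<longleftrightarrow> bij_betw f U U' \<and>
     (\<forall>x\<in>U. \<forall>y\<in>U. f (add S x y) = add T (f x) (f y)) \<and> (\<forall>c. \<forall>x\<in>U. f (scl S c x) = scl T c (f x))"

text \<open>Lists of length n play the role of the coordinate space; unique existence in
  \<open>has_dim\<close> says that taking linear combinations is a bijection from them, and
  \<open>coords\<close> is its inverse.\<close>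

lemma (in carrier_superspace) has_dim_coords:
  assumes U: "subspace_of S U" and dim: "has_dim S U n"
  obtains coords where "bij_betw coords U {cs. length cs = n}"
    and "\<And>x y. x \<in> U \<Longrightarrow> y \<in> U \<Longrightarrow> coords (add S x y) = map2 (+) (coords x) (coords y)"
    and "\<And>c x. x \<in> U \<Longrightarrow> coords (scl S c x) = map ((*) c) (coords x)"
proof -
  obtain bs where bs: "length bs = n" "set bs \<subseteq> U"
    and ex1: "\<And>x. x \<in> U \<Longrightarrow> \<exists>!cs. length cs = n \<and> lincomb S cs bs = x"
    using dim by (auto simp: has_dim_def)
  define coords where "coords x = (THE cs. length cs = n \<and> lincomb S cs bs = x)" for x
  have coords: "length (coords x) = n" "lincomb S (coords x) bs = x" if "x \<in> U" for x
    using theI'[OF ex1[OF that]] by (simp_all add: coords_def)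
  have coords_eq: "coords x = cs" if "x \<in> U" "length cs = n" "lincomb S cs bs = x" for x cs
    using ex1[OF that(1)] coords[OF that(1)] that by blast
  have in_U: "lincomb S cs bs \<in> U" if "length cs = n" for cs
    using lincomb_in[OF U] bs that by simp
  have bs_carr: "set bs \<subseteq> carr S" using U bs by (auto simp: subspace_of_def)
  show ?thesis
  proof
    show "bij_betw coords U {cs. length cs = n}"
      by (rule bij_betw_byWitness[where f' = "\<lambda>cs. lincomb S cs bs"])
        (auto simp: coords coords_eq in_U)
    show "coords (add S x y) = map2 (+) (coords x) (coords y)" if "x \<in> U" "y \<in> U" for x y
      using U that by (intro coords_eq) (simp_all add: subspace_of_def coords lincomb_add bs bs_carr)
    show "coords (scl S c x) = map ((*) c) (coords x)" if "x \<in> U" for c x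
      using U that by (intro coords_eq) (simp_all add: subspace_of_def coords lincomb_scl bs bs_carr)
  qed
qed

lemma partial_iso_exists:
  assumes S: "is_superspace S" and T: "is_superspace T"
    and U: "subspace_of S U" and U': "subspace_of T U'" and dim: "has_dim S U n" "has_dim T U' n"
  obtains f where "partial_iso S U T U' f"
proof -
  interpret S: carrier_superspace S by unfold_locales (rule S)
  interpret T: carrier_superspace T by unfold_locales (rule T)
  obtain c where c: "bij_betw c U {cs. length cs = n}"
    "\<And>x y. x \<in> U \<Longrightarrow> y \<in> U \<Longrightarrow> c (add S x y) = map2 (+) (c x) (c y)"
    "\<And>r x. x \<in> U \<Longrightarrow> c (scl S r x) = map ((*) r) (c x)"
    using S.has_dim_coords[OF U dim(1)] by metis
  obtain d where d: "bij_betw d U' {cs. length cs = n}"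
    "\<And>x y. x \<in> U' \<Longrightarrow> y \<in> U' \<Longrightarrow> d (add T x y) = map2 (+) (d x) (d y)"
    "\<And>r x. x \<in> U' \<Longrightarrow> d (scl T r x) = map ((*) r) (d x)"
    using T.has_dim_coords[OF U' dim(2)] by metis
  define f where "f = inv_into U' d \<circ> c"
  have f: "bij_betw f U U'"
    unfolding f_def using c(1) bij_betw_inv_into[OF d(1)] by (rule bij_betw_trans)
  have df: "d (f x) = c x" if "x \<in> U" for x
    using bij_betw_inv_into_right[OF d(1), of "c x"] bij_betwE[OF c(1)] that by (auto simp: f_def)
  have inj: "x = y" if "x \<in> U'" "y \<in> U'" "d x = d y" for x y
    using d(1) that by (auto simp: bij_betw_def dest: inj_onD)
  note f_in = bij_betwE[OF f, rule_format]
  have "f (add S x y) = add T (f x) (f y)" if "x \<in> U" "y \<in> U" for x y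
    using that U U' f_in by (intro inj) (simp_all add: df c d subspace_of_def)
  moreover have "f (scl S r x) = scl T r (f x)" if "x \<in> U" for r x
    using that U U' f_in by (intro inj) (simp_all add: df c d subspace_of_def)
  ultimately show ?thesis
    by (intro that[of f]) (simp add: partial_iso_def f)
qed


lemma partial_iso_zer:
  assumes "is_superspace S" "is_superspace T" "partial_iso S U T U' f" "zer S \<in> U" "U' \<subseteq> carr T"
  shows "f (zer S) = zer T"
proof -
  interpret S: carrier_superspace S by unfold_locales (rule assms)
  interpret T: carrier_superspace T by unfold_locales (rule assms)
  have "f (zer S) \<in> carr T"
    using assms by (auto simp: partial_iso_def dest: bij_betwE)
  moreover have "f (scl S 0 (zer S)) = scl T 0 (f (zer S))"
    using assms unfolding partial_iso_def by blast
  ultimately show ?thesis by simp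
qed

lemma partial_iso_trans:
  "partial_iso S U T U' f \<Longrightarrow> partial_iso T U' T' U'' g \<Longrightarrow> partial_iso S U T' U'' (g \<circ> f)"
  by (auto simp: partial_iso_def intro: bij_betw_trans dest: bij_betwE)

text \<open>The map \<open>x \<mapsto> x + (\<phi> x / \<phi> v) (u - v)\<close> sends \<open>v\<close> to \<open>u\<close>, and it is invertible
  if \<open>\<phi> u \<noteq> 0\<close>.\<close>

lemma partial_iso_moving:
  assumes S: "is_superspace S" and U: "subspace_of S U" and dim: "has_dim S U n"
    and v: "v \<in> U" "v \<noteq> zer S" and u: "u \<in> U" "u \<noteq> zer S"
  obtains f where "partial_iso S U S U f" "f v = u"
proof -
  interpret carrier_superspace S by unfold_locales (rule S)
  have U_add: "add S x y \<in> U" and U_scl: "scl S c x \<in> U" and U_carr: "x \<in> carr S" and U_zer: "zer S \<in> U"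
    if "x \<in> U" "y \<in> U" for c x y
    using U that by (auto simp: subspace_of_def)
  obtain d where d: "bij_betw d U {cs. length cs = n}"
    "\<And>x y. x \<in> U \<Longrightarrow> y \<in> U \<Longrightarrow> d (add S x y) = map2 (+) (d x) (d y)"
    "\<And>r x. x \<in> U \<Longrightarrow> d (scl S r x) = map ((*) r) (d x)"
    using has_dim_coords[OF U dim] by metis
  have len: "length (d x) = n" if "x \<in> U" for x
    using bij_betwE[OF d(1)] that by auto
  have lin: "d (add S x y) ! i = d x ! i + d y ! i" "d (scl S c x) ! i = c * d x ! i"
    if "x \<in> U" "y \<in> U" "i < n" for x y c i
    using that by (simp_all add: d len)
  have nz: "\<exists>i<n. d x ! i \<noteq> 0" if "x \<in> U" "x \<noteq> zer S" for x
  proof (rule ccontr)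
    assume *: "\<not> (\<exists>i<n. d x ! i \<noteq> 0)"
    have z: "zer S \<in> U" by (rule U_zer[OF that(1) that(1)])
    have "d (zer S) ! i = 0" if "i < n" for i
      using lin(2)[OF z z that, of 0] by simp
    then have "d x = d (zer S)"
      using * that(1) z by (intro nth_equalityI) (simp_all add: len)
    then show False
      using d(1) that z by (auto simp: bij_betw_def dest: inj_onD)
  qed
  obtain i j where i: "i < n" "d v ! i \<noteq> 0" and j: "j < n" "d u ! j \<noteq> 0"
    using nz[OF v] nz[OF u] by blast
  have "\<exists>\<phi>. (\<forall>x\<in>U. \<forall>y\<in>U. \<phi> (add S x y) = \<phi> x + \<phi> y) \<and> (\<forall>c. \<forall>x\<in>U. \<phi> (scl S c x) = c * \<phi> x)
      \<and> \<phi> v \<noteq> 0 \<and> \<phi> u \<noteq> 0"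
  proof -
    \<comment> \<open>A coordinate that is nonzero at one vector may also be nonzero at the other.
      If neither of the two coordinates is, their sum takes the values \<open>d v ! i\<close> and
      \<open>d u ! j\<close>.\<close>
    consider "d u ! i \<noteq> 0" | "d v ! j \<noteq> 0" | "d u ! i = 0" "d v ! j = 0" by blast
    then show ?thesis
    proof cases
      case 1
      then show ?thesis using i lin by (intro exI[of _ "\<lambda>x. d x ! i"]) auto
    next
      case 2
      then show ?thesis using j lin by (intro exI[of _ "\<lambda>x. d x ! j"]) auto
    next
      case 3
      then show ?thesis using i j lin
        by (intro exI[of _ "\<lambda>x. d x ! i + d x ! j"]) (auto simp: algebra_simps)
    qed
  qed
  then obtain \<phi> where \<phi>: "\<And>x y. x \<in> U \<Longrightarrow> y \<in> U \<Longrightarrow> \<phi> (add S x y) = \<phi> x + \<phi> y"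
    "\<And>c x. x \<in> U \<Longrightarrow> \<phi> (scl S c x) = c * \<phi> x" and nonzero: "\<phi> v \<noteq> 0" "\<phi> u \<noteq> 0"
    by blast
  define h where "h k x = add S x (scl S (\<phi> x * k) (sub S u v))" for k x
  have w: "sub S u v \<in> U" using u v U_add U_scl by (simp add: sub_def neg_def)
  have \<phi>_w: "\<phi> (sub S u v) = \<phi> u - \<phi> v"
    using u v U_scl by (simp add: sub_def neg_def \<phi>)
  have h_in: "h k x \<in> U" if "x \<in> U" for k x
    using that w U_add U_scl by (simp add: h_def)
  have h_add: "h k (add S x y) = add S (h k x) (h k y)" if x: "x \<in> U" and y: "y \<in> U" for k x y
  proof -
    note c = U_carr[OF x x] U_carr[OF y y] U_carr[OF w w]
    have "add S (add S x y) (add S (scl S (\<phi> x * k) (sub S u v)) (scl S (\<phi> y * k) (sub S u v))) =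
      add S (add S x (scl S (\<phi> x * k) (sub S u v))) (add S y (scl S (\<phi> y * k) (sub S u v)))"
      using c by (simp add: add_swap[of x y])
    then show ?thesis using x y c by (simp add: h_def \<phi> distrib_right add_scl)
  qed
  have h_scl: "h k (scl S c x) = scl S c (h k x)" if x: "x \<in> U" for c k x
    using U_carr[OF x x] U_carr[OF w w] x by (simp add: h_def \<phi> scl_add scl_scl mult.assoc)
  have h_h: "h l (h k x) = x" if x: "x \<in> U" and kl: "k + l + k * l * (\<phi> u - \<phi> v) = 0" for k l x
  proof -
    note c = U_carr[OF x x] U_carr[OF w w]
    have "\<phi> (h k x) = \<phi> x + \<phi> x * k * (\<phi> u - \<phi> v)"
      using x w U_scl by (simp add: h_def \<phi> \<phi>_w)
    then have "h l (h k x) = add S x (scl S (\<phi> x * k + (\<phi> x + \<phi> x * k * (\<phi> u - \<phi> v)) * l) (sub S u v))"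
      using c by (simp add: h_def add_assoc flip: add_scl)
    also have "\<phi> x * k + (\<phi> x + \<phi> x * k * (\<phi> u - \<phi> v)) * l = \<phi> x * (k + l + k * l * (\<phi> u - \<phi> v))"
      by (simp add: algebra_simps)
    finally show ?thesis using kl c by simp
  qed
  \<comment> \<open>With ?k the multiple of u - v added to v is exactly 1, so v goes to u. The value
    ?l solves k + l + k l (\<phi> u - \<phi> v) = 0, the condition for the inverse.\<close>
  let ?k = "1 / \<phi> v" and ?l = "- (1 / \<phi> u)"
  have "bij_betw (h ?k) U U"
    using nonzero by (intro bij_betw_byWitness[where f' = "h ?l"]) (auto simp: h_in h_h field_simps)
  then have "partial_iso S U S U (h ?k)"
    by (simp add: partial_iso_def h_add h_scl)
  moreover have "h ?k v = u"
  proof -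
    note c = U_carr[OF u(1) u(1)] U_carr[OF v(1) v(1)]
    have "h ?k v = add S v (add S u (neg S v))"
      using nonzero c by (simp add: h_def sub_def)
    also have "\<dots> = add S (add S v (neg S v)) u"
      using c by (simp add: add_commute[of u] add_assoc)
    finally show ?thesis using c by (simp add: add_neg)
  qed
  ultimately show ?thesis using that by blast
qed

lemma has_dim_0:
  assumes "subspace_of S U"
  shows "has_dim S U 0 \<longleftrightarrow> U = {zer S}"
  using assms by (auto simp: has_dim_def subspace_of_def)

lemma (in carrier_superspace) has_dim_singleton:
  assumes "has_dim S {zer S} n"
  shows "n = 0"
proof -
  obtain bs where bs: "length bs = n" "set bs \<subseteq> {zer S}"
    and ex1: "\<exists>!cs. length cs = n \<and> lincomb S cs bs = zer S"
    using assms by (auto simp: has_dim_def)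
  have "subspace_of S {zer S}" by (simp add: subspace_of_def)
  then have "lincomb S cs bs = zer S" if "length cs = n" for cs
    using lincomb_in bs that by blast
  \<comment> \<open>Every list of coefficients represents zero here, so uniqueness identifies these
    two lists, which differ in each entry.\<close>
  then have "replicate n (0::'f) = replicate n 1"
    using ex1 by (metis length_replicate)
  then show ?thesis by simp
qed

text \<open>This is the independence of U(k, m) from the chosen even vector. An arbitrary
  isomorphism of the even parts is corrected by \<open>partial_iso_moving\<close>, which needs
  nonzero vectors; then the even and odd parts are glued along the decomposition.\<close>

lemma graded_iso_exists:
  assumes S: "is_superspace S" and T: "is_superspace T"
    and dim: "has_sdim S k m" "has_sdim T k m"
    and v: "v \<in> part S 0" and u: "u \<in> part T 0" and zer: "v = zer S \<longleftrightarrow> u = zer T"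
  obtains f where "graded_iso S T f" "f v = u"
proof -
  interpret S: carrier_superspace S by unfold_locales (rule S)
  interpret T: carrier_superspace T by unfold_locales (rule T)
  have dims: "has_dim S (part S 0) k" "has_dim T (part T 0) k" "has_dim S (part S 1) m" "has_dim T (part T 1) m"
    using dim by (auto simp: has_sdim_def)
  obtain f where f: "partial_iso S (part S 0) T (part T 0) f"
    by (rule partial_iso_exists[OF S T S.subspace_of_part T.subspace_of_part dims(1,2)])
  have f_zer: "f (zer S) = zer T"
    using partial_iso_zer[OF S T f] T.part_carr by auto
  obtain f0 where f0: "partial_iso S (part S 0) T (part T 0) f0" "f0 v = u"
  proof (cases "v = zer S")
    case True
    then show ?thesis using that[OF f] zer f_zer by simp
  next
    case False
    have inj: "inj_on f (part S 0)" and fv: "f v \<in> part T 0"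
      using f v by (auto simp: partial_iso_def bij_betw_def)
    have "f v \<noteq> zer T"
      using False inj v f_zer S.part_zer by (metis inj_onD)
    then obtain g where "partial_iso T (part T 0) T (part T 0) g" "g (f v) = u"
      using partial_iso_moving[OF T T.subspace_of_part dims(2) fv _ u] False zer by metis
    then show ?thesis using that partial_iso_trans[OF f] by force
  qed
  obtain f1 where f1: "partial_iso S (part S 1) T (part T 1) f1"
    by (rule partial_iso_exists[OF S T S.subspace_of_part T.subspace_of_part dims(3,4)])
  define h where "h p = (if p = 0 then f0 else f1)" for p :: bit
  have h: "partial_iso S (part S p) T (part T p) (h p)" for p
    using f0(1) f1 by (cases p) (simp_all add: h_def)
  have h_bij: "bij_betw (h p) (part S p) (part T p)" for p
    using h by (simp add: partial_iso_def)
  have h_in: "h p x \<in> part T p" if "x \<in> part S p" for p x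
    using h_bij that by (auto dest: bij_betwE)
  have h_add: "h p (add S x y) = add T (h p x) (h p y)" if "x \<in> part S p" "y \<in> part S p" for p x y
    using h that by (auto simp: partial_iso_def)
  have h_scl: "h p (scl S c x) = scl T c (h p x)" if "x \<in> part S p" for p c x
    using h that by (auto simp: partial_iso_def)
  have h_zer: "h p (zer S) = zer T" for p
    using partial_iso_zer[OF S T h] T.part_carr by auto
  define F where "F x = add T (h 0 (component S 0 x)) (h 1 (component S 1 x))" for x
  have comp_S: "component S 0 (add S y z) = y" "component S 1 (add S y z) = z"
    if "y \<in> part S 0" "z \<in> part S 1" for y z
    using S.component_unique[of y 0 z] S.component_unique[of z 1 y] that S.add_commute[of y z]
    by (simp_all add: S.part_carr)
  have comp_T: "component T 0 (add T y z) = y" "component T 1 (add T y z) = z"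
    if "y \<in> part T 0" "z \<in> part T 1" for y z
    using T.component_unique[of y 0 z] T.component_unique[of z 1 y] that T.add_commute[of y z]
    by (simp_all add: T.part_carr)
  have F_sum: "F (add S y z) = add T (h 0 y) (h 1 z)" if "y \<in> part S 0" "z \<in> part S 1" for y z
    using that by (simp add: F_def comp_S)
  have split: "\<exists>y\<in>part S 0. \<exists>z\<in>part S 1. x = add S y z" if "x \<in> carr S" for x
    using S.component_in[OF that] S.component_sum[OF that] by metis
  have "linear_on S T F"
    unfolding linear_on_def
  proof (intro conjI ballI allI)
    show "F \<in> carr S \<rightarrow> carr T"
      unfolding F_def by (intro Pi_I T.add_closed T.part_carr[OF h_in] S.component_in)
    fix x assume "x \<in> carr S"
    then obtain y z where x: "y \<in> part S 0" "z \<in> part S 1" "x = add S y z" using split by blast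
    show "F (scl S c x) = scl T c (F x)" for c
      using x by (simp add: S.scl_add S.part_carr F_sum S.part_scl h_scl T.scl_add T.part_carr[OF h_in])
    fix x' assume "x' \<in> carr S"
    then obtain y' z' where x': "y' \<in> part S 0" "z' \<in> part S 1" "x' = add S y' z'" using split by blast
    have "F (add S x x') = F (add S (add S y y') (add S z z'))"
      using x x' by (simp add: S.add_swap[of y z y' z'] S.part_carr)
    also have "\<dots> = add T (add T (h 0 y) (h 0 y')) (add T (h 1 z) (h 1 z'))"
      using x x' by (simp add: F_sum S.part_add h_add)
    also have "\<dots> = add T (F x) (F x')"
      using x x' by (simp add: F_sum T.add_swap[of "h 0 y" "h 0 y'" "h 1 z" "h 1 z'"] T.part_carr[OF h_in])
    finally show "F (add S x x') = add T (F x) (F x')" .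
  qed
  moreover have "bij_betw F (carr S) (carr T)"
    unfolding bij_betw_def
  proof
    show "inj_on F (carr S)"
    proof (rule inj_onI)
      fix x x' assume "x \<in> carr S" "x' \<in> carr S" and eq: "F x = F x'"
      then obtain y z y' z' where x: "y \<in> part S 0" "z \<in> part S 1" "x = add S y z"
        and x': "y' \<in> part S 0" "z' \<in> part S 1" "x' = add S y' z'"
        using split by metis
      have "h 0 y = h 0 y'" "h 1 z = h 1 z'"
        using eq comp_T[OF h_in h_in] x x' by (metis F_sum)+
      then have "y = y'" "z = z'"
        using h_bij x x' by (metis bij_betw_def inj_onD)+
      then show "x = x'" using x x' by simp
    qed
    show "F ` carr S = carr T"
    proof
      show "F ` carr S \<subseteq> carr T"
        using \<open>linear_on S T F\<close> by (auto simp: linear_on_def)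
      show "carr T \<subseteq> F ` carr S"
      proof
        fix w assume w: "w \<in> carr T"
        obtain y where y: "y \<in> part S 0" "h 0 y = component T 0 w"
          using h_bij[of 0] T.component_in[OF w, of 0] by (metis bij_betw_imp_surj_on imageE)
        obtain z where z: "z \<in> part S 1" "h 1 z = component T 1 w"
          using h_bij[of 1] T.component_in[OF w, of 1] by (metis bij_betw_imp_surj_on imageE)
        have "F (add S y z) = w"
          using y z T.component_sum[OF w] by (simp add: F_sum)
        then show "w \<in> F ` carr S"
          using y z S.part_carr by (metis S.add_closed imageI)
      qed
    qed
  qed
  moreover have F_part: "F x = h p x" if "x \<in> part S p" for x p
  proof -
    have "F (add S x (zer S)) = h p x" if "p = 0"
      using that \<open>x \<in> part S p\<close> F_sum[of x "zer S"] h_in[of x p] by (simp add: h_zer T.part_carr)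
    moreover have "F (add S (zer S) x) = h p x" if "p = 1"
      using that \<open>x \<in> part S p\<close> F_sum[of "zer S" x] h_in[of x p] by (simp add: h_zer T.part_carr)
    ultimately show ?thesis
      using S.part_carr[OF \<open>x \<in> part S p\<close>] by (cases p) simp_all
  qed
  ultimately have "graded_iso S T F"
    using h_in by (auto simp: graded_iso_def)
  moreover have "F v = u"
    using F_part[OF v] f0(2) by (simp add: h_def)
  ultimately show ?thesis using that by blast
qed

lemma has_sdim_adjoin_even:
  assumes S: "is_superspace S" and dim: "has_sdim S n m"
  shows "has_sdim (adjoin_even S) (n + 1) m"
proof -
  interpret carrier_superspace S by unfold_locales (rule S)
  have lincomb: "lincomb (adjoin_even S) cs (map (\<lambda>b. (b, 0)) bs) = (lincomb S cs bs, 0)"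
    if "length cs = length bs" for cs bs
    using that by (induction cs bs rule: list_induct2) (auto simp: adjoin_even_def)
  obtain bs where bs: "length bs = n" "set bs \<subseteq> part S 0"
    and ex1: "\<And>x. x \<in> part S 0 \<Longrightarrow> \<exists>!cs. length cs = n \<and> lincomb S cs bs = x"
    using dim by (auto simp: has_sdim_def has_dim_def)
  obtain bs' where bs': "length bs' = m" "set bs' \<subseteq> part S 1"
    and ex1': "\<And>x. x \<in> part S 1 \<Longrightarrow> \<exists>!cs. length cs = m \<and> lincomb S cs bs' = x"
    using dim by (auto simp: has_sdim_def has_dim_def)
  \<comment> \<open>The vector \<epsilon> comes first, so the head of a list of coefficients is the
    coefficient of \<epsilon>.\<close>
  let ?bs = "(zer S, 1) # map (\<lambda>b. (b, 0)) bs"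
  have "lincomb S cs bs \<in> carr S" if "length cs = n" for cs
    using lincomb_in[OF subspace_of_part] bs that part_carr by metis
  then have lincomb_Cons: "lincomb (adjoin_even S) (c # cs) ?bs = (lincomb S cs bs, c)" if "length cs = n" for c cs
    using that bs by (simp add: lincomb) (simp add: adjoin_even_def)
  have "has_dim (adjoin_even S) (part (adjoin_even S) 0) (n + 1)"
    unfolding has_dim_def
  proof (intro exI[of _ ?bs] conjI ballI)
    show "length ?bs = n + 1" "set ?bs \<subseteq> part (adjoin_even S) 0"
      using bs by (auto simp: adjoin_even_def)
    fix p assume "p \<in> part (adjoin_even S) 0"
    then obtain x c where p: "p = (x, c)" "x \<in> part S 0" by (auto simp: adjoin_even_def)
    then obtain cs where cs: "length cs = n" "lincomb S cs bs = x"
      and unique: "\<And>ds. length ds = n \<Longrightarrow> lincomb S ds bs = x \<Longrightarrow> ds = cs"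
      using ex1 by metis
    show "\<exists>!cs. length cs = n + 1 \<and> lincomb (adjoin_even S) cs ?bs = p"
    proof (rule ex1I[of _ "c # cs"])
      show "length (c # cs) = n + 1 \<and> lincomb (adjoin_even S) (c # cs) ?bs = p"
        unfolding lincomb_Cons[OF cs(1)] using cs p by simp
      fix ds assume ds: "length ds = n + 1 \<and> lincomb (adjoin_even S) ds ?bs = p"
      then obtain d ds' where "ds = d # ds'" "length ds' = n" by (cases ds) auto
      then show "ds = c # cs"
        using ds unique[of ds'] p(1) by (simp only: lincomb_Cons) simp
    qed
  qed
  moreover have "has_dim (adjoin_even S) (part (adjoin_even S) 1) m"
    unfolding has_dim_def
  proof (intro exI[of _ "map (\<lambda>b. (b, 0)) bs'"] conjI ballI)
    show "length (map (\<lambda>b. (b, 0)) bs') = m" "set (map (\<lambda>b. (b, 0)) bs') \<subseteq> part (adjoin_even S) 1"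
      using bs' by (auto simp: adjoin_even_def)
    fix p assume "p \<in> part (adjoin_even S) 1"
    then obtain x where p: "p = (x, 0)" "x \<in> part S 1" by (auto simp: adjoin_even_def)
    have "(length cs = m \<and> lincomb (adjoin_even S) cs (map (\<lambda>b. (b, 0)) bs') = p) \<longleftrightarrow>
        (length cs = m \<and> lincomb S cs bs' = x)" for cs
      using lincomb[of cs bs'] bs'(1) by (auto simp: p(1))
    then show "\<exists>!cs. length cs = m \<and> lincomb (adjoin_even S) cs (map (\<lambda>b. (b, 0)) bs') = p"
      using ex1'[OF p(2)] by simp
  qed
  ultimately show ?thesis by (simp add: has_sdim_def)
qed

theorem theorem11:
  fixes scale :: "'f::field \<Rightarrow> 'v::ab_group_add \<Rightarrow> 'v"
    and G :: "bit \<Rightarrow> 'v set"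
    and M star :: "'v \<Rightarrow> 'v \<Rightarrow> 'v"
  assumes "superspace scale G"
    and "superspace.superalgebra scale G M"
    and "superspace.conservative scale G M"
    and "superspace.associated_mult scale G M star"
  shows
    "let V = superspace.space scale G;
         J = superspace.jacobi_space scale G M;
         VJ = superspace.quotient scale G J
     in
     (\<forall>e. superspace.left_quasiunity G M e \<longrightarrow>
        (let W = VJ; \<epsilon> = superspace.coset J e; ad = superspace.ad_quasiunital scale G M star in
         superalgebra_hom V M (bilinear_space W) (triangle W (neg W \<epsilon>)) ad \<and>
         superspace.maximal_jacobi_ideal scale G M (hom_kernel V (bilinear_space W) ad)))
     \<and>
     ((\<nexists>e. superspace.left_quasiunity G M e) \<longrightarrow>
        (let W = adjoin_even VJ; \<epsilon> = adjoined_unit VJ; ad = superspace.ad_extended scale G M star in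
         superalgebra_hom V M (bilinear_space W) (triangle W (neg W \<epsilon>)) ad \<and>
         superspace.maximal_jacobi_ideal scale G M (hom_kernel V (bilinear_space W) ad)))
     \<and>
     (\<forall>n m k (W' :: ('f, 'w) sspace) u.
        (\<exists>Basis. finite_dimensional_vector_space scale Basis) \<longrightarrow>
        has_sdim VJ n m \<longrightarrow>
        k = (if \<exists>e. superspace.left_quasiunity G M e then n else n + 1) \<longrightarrow>
        represents_U W' u k m \<longrightarrow>
        (\<exists>ad. superalgebra_hom V M (bilinear_space W') (triangle W' u) ad \<and>
              superspace.maximal_jacobi_ideal scale G M (hom_kernel V (bilinear_space W') ad)))"
proof -
  interpret superspace scale G by (rule assms(1))
  interpret conservative_superalgebra scale G M star
    using assms(2,4) by unfold_locales (simp_all add: superalgebra_def bilinear_space_space)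
  let ?\<epsilon> = "adjoined_unit (quotient J)"
  \<comment> \<open>Stated for any instance of the locale, so that it covers both definitions of
    W.\<close>
  have part3: "\<exists>ad. superalgebra_hom space M (bilinear_space W') (triangle W' u) ad \<and>
      maximal_jacobi_ideal M (hom_kernel space (bilinear_space W') ad)"
    if rep: "adjoint_rep scale G S M \<Phi> \<epsilon> ad" and dim: "has_sdim S k m" and W': "represents_U W' u k m"
      and nonzero: "k \<noteq> 0 \<Longrightarrow> \<epsilon> \<noteq> zer S"
    for S :: "('f, 's) sspace" and \<Phi> \<epsilon> ad k m u and W' :: "('f, 'w) sspace"
  proof -
    interpret S: adjoint_rep scale G S M \<Phi> \<epsilon> ad by (rule rep)
    interpret W': carrier_superspace W' using W' by unfold_locales (simp add: represents_U_def)
    have u: "u \<in> part W' 0" "u \<noteq> zer W' \<or> k = 0" and dim': "has_sdim W' k m"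
      using W' by (auto simp: represents_U_def)
    have u_carr: "u \<in> carr W'" by (rule W'.part_carr[OF u(1)])
    have neg_neg: "neg W' (neg W' u) = u"
      using u_carr by (simp add: neg_def W'.scl_scl)
    have neg_zer: "neg W' u = zer W' \<longleftrightarrow> u = zer W'"
      using neg_neg by (metis W'.scl_zer neg_def)
    \<comment> \<open>Since \<open>homomorphism\<close> yields the product at the negative of the
      distinguished vector, - u has to correspond to \<epsilon>. For k = 0 both even parts are zero;
      otherwise both vectors are nonzero.\<close>
    have "neg W' u = zer W' \<longleftrightarrow> \<epsilon> = zer S"
    proof (cases "k = 0")
      case True
      then have "part W' 0 = {zer W'}" "part S 0 = {zer S}"
        using dim dim' has_dim_0[OF W'.subspace_of_part] has_dim_0[OF S.subspace_of_part]
        by (auto simp: has_sdim_def)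
      then show ?thesis using u(1) S.eps_part neg_zer by auto
    next
      case False
      then show ?thesis using nonzero u neg_zer by auto
    qed
    then obtain f where f: "graded_iso W' S f" "f (neg W' u) = \<epsilon>"
      by (rule graded_iso_exists[OF W'.is_superspace S.is_superspace dim' dim W'.part_neg[OF u(1)] S.eps_part])
    interpret W': adjoint_rep scale G W' M "\<Phi> \<circ> f" "neg W' u"
        "\<lambda>a. \<lambda>x\<in>carr W'. \<lambda>y\<in>carr W'. inv_into (carr W') f (ad a (f x) (f y))"
      by (rule S.transport[OF W'.is_superspace f(1) W'.part_neg[OF u(1)] f(2)])
    show ?thesis
      using W'.homomorphism W'.kernel_maximal unfolding neg_neg by blast
  qed
  \<comment> \<open>If e were in J, then M = - [L_e, M] would be zero. Every element would then be
    Jacobi and V/J would be zero, against k > 0.\<close>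
  have quasiunital_nonzero: "coset J e \<noteq> zer (quotient J)"
    if e: "left_quasiunity M e" and dim: "has_sdim (quotient J) k m" and "k \<noteq> 0" for e k m
  proof
    interpret S: adjoint_rep scale G "quotient J" M Phi_VJ "coset J e" "ad_quasiunital M star"
      by (rule adjoint_rep_quasiunital[OF e])
    assume "coset J e = zer (quotient J)"
    then have "M x y = 0" for x y
      using S.Phi_eps[of x y] S.Phi_zer[of x y] by simp
    then have "x \<in> J" for x
      by (simp add: jacobi_space_iff[OF bil_M] brk_def)
    then have "coset J x = zer (quotient J)" for x
      by (simp add: VJ coset_eq_iff[OF subspace_J])
    then have "part (quotient J) 0 = {zer (quotient J)}"
      using S.part_zer[of 0] unfolding VJ(6) by auto
    then show False
      using S.has_dim_singleton dim \<open>k \<noteq> 0\<close> by (metis has_sdim_def)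
  qed
  show ?thesis
    unfolding Let_def
  proof (intro conjI allI impI)
    fix e assume e: "left_quasiunity M e"
    interpret S: adjoint_rep scale G "quotient J" M Phi_VJ "coset J e" "ad_quasiunital M star"
      by (rule adjoint_rep_quasiunital[OF e])
    show "superalgebra_hom space M (bilinear_space (quotient J))
        (triangle (quotient J) (neg (quotient J) (coset J e))) (ad_quasiunital M star)"
      "maximal_jacobi_ideal M (hom_kernel space (bilinear_space (quotient J)) (ad_quasiunital M star))"
      by (rule S.homomorphism, rule S.kernel_maximal)
  next
    assume "\<nexists>e. left_quasiunity M e"
    then interpret S: adjoint_rep scale G "adjoin_even (quotient J)" M Phi_ext ?\<epsilon> "ad_extended M star"
      by (rule adjoint_rep_extended)
    show "superalgebra_hom space M (bilinear_space (adjoin_even (quotient J)))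
        (triangle (adjoin_even (quotient J)) (neg (adjoin_even (quotient J)) ?\<epsilon>)) (ad_extended M star)"
      "maximal_jacobi_ideal M (hom_kernel space (bilinear_space (adjoin_even (quotient J))) (ad_extended M star))"
      by (rule S.homomorphism, rule S.kernel_maximal)
  next
    fix n m k and W' :: "('f, 'w) sspace" and u
    assume dim: "has_sdim (quotient J) n m"
      and k: "k = (if \<exists>e. left_quasiunity M e then n else n + 1)" and W': "represents_U W' u k m"
    show "\<exists>ad. superalgebra_hom space M (bilinear_space W') (triangle W' u) ad \<and>
        maximal_jacobi_ideal M (hom_kernel space (bilinear_space W') ad)"
    proof (cases "\<exists>e. left_quasiunity M e")
      case True
      then obtain e where e: "left_quasiunity M e" ..
      have "k = n" using k True by simp
      then show ?thesis
        using part3[OF adjoint_rep_quasiunital[OF e] dim] W' quasiunital_nonzero[OF e dim] by simp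
    next
      case False
      then have "k = n + 1" using k by simp
      then show ?thesis
        using part3[OF adjoint_rep_extended[OF False] has_sdim_adjoin_even[OF is_superspace_VJ dim]] W'
        by (simp add: adjoin_even_def adjoined_unit_def)
    qed
  qed
qed

end
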